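(* As formal power series, $A_{\{1,3,4\}}(x,y) = \dfrac{f}{g}$, where \begin{align*} f &= 1-2x+2x^2-2x^3+x^4-x^2y,\\ g &= 1-x(2+y) +x^2(2+y) - x^3(2+2y+y^2+y^3) +x^4(1-2y+2y^3-y^4) \\ &\quad + x^5(5y-2y^3+3y^4) + x^6(-4y+2y^3-2y^4+y^5) + x^7(2y-y^3+2y^4) - x^8y^4, \end{align*} and for any integer $c \geq 1$, $A_{\{c,3c,4c\}}(x,y) = A_{\{1,3,4\}}(x^c,y^c)$.
   Context: A composition of $n$ is an ordered list of positive integers (parts) with sum $n$; the empty list is the unique composition of $0$. A meander on $n$ nodes is a pair $\frac{\lambda}{\mu}$ of compositions of $n$, viewed as a planar (multi)graph on vertices $1,\dots,n$: for each part $a$ of $\lambda$, occupying the consecutive vertices $p+1,\dots,p+a$ (where $p$ is the sum of the preceding parts), there is an upper edge joining $p+i$ and $p+a+1-i$ for each $1\le i\le \lfloor a/2\rfloor$; lower edges are defined in the same way from $\mu$. If the same two vertices are joined by both an upper and a lower edge, both edges are kept and form a cycle. Every connected component is a cycle or a path (an isolated vertex counts as a path). The index is $\operatorname{ind}(\frac{\lambda}{\mu}) = 2c+p$, where here $c$ is the number of cycles and $p$ is the number of paths (this equals the index of the associated seaweed subalgebra of $\mathfrak{gl}_n$). For a set $J$ of positive integers, $a^J_{n,k}$ is the number of meanders $\frac{\lambda}{\mu}$ on $n$ nodes of index $k$ such that all parts of $\lambda$ and $\mu$ lie in $J$, and $A_J(x,y)=\sum_{n,k\ge 0} a^J_{n,k}x^ny^k$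 (the empty meander gives $a^J_{0,0}=1$). *)

theory Defs
  imports "HOL-Computational_Algebra.Formal_Power_Series"
begin

definition composition :: "nat \<Rightarrow> nat list \<Rightarrow> bool" where
  "composition n l \<longleftrightarrow> (\<forall>a\<in>set l. a \<ge> 1) \<and> sum_list l = n"

(* The edges contributed by one composition, each as the set of its two end points.
   The part l ! j occupies the vertices p + 1, ..., p + l ! j, where p is the sum of the
   preceding parts. *)
definition arcs :: "nat list \<Rightarrow> nat set set" where
  "arcs l = {{p + i, p + l ! j + 1 - i} |p i j.
     j < length l \<and> p = sum_list (take j l) \<and> 1 \<le> i \<and> i \<le> l ! j div 2}"

datatype side = Upper | Lower

(* Tagging with the side keeps both members of a parallel pair of edges. *)
type_synonym edge = "side \<times> nat set"

definition meander_edges :: "nat list \<Rightarrow> nat list \<Rightarrow> edge set" where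
  "meander_edges u l = Pair Upper ` arcs u \<union> Pair Lower ` arcs l"

definition adjacency :: "edge set \<Rightarrow> (nat \<times> nat) set" where
  "adjacency E = {(v, w). \<exists>e\<in>E. snd e = {v, w}}"

definition components :: "nat set \<Rightarrow> edge set \<Rightarrow> nat set set" where
  "components V E = (\<lambda>v. (adjacency E)\<^sup>* `` {v}) ` V"

definition edges_within :: "edge set \<Rightarrow> nat set \<Rightarrow> edge set" where
  "edges_within E C = {e \<in> E. snd e \<subseteq> C}"

(* The subgraph induced on C is a path: its vertices and its edges can be listed without
   repetition as v_0, ..., v_m and e_0, ..., e_(m-1) such that e_i joins v_i and v_(i+1).
   An isolated vertex is the case m = 0. *)
definition is_path :: "edge set \<Rightarrow> nat set \<Rightarrow> bool" where
  "is_path E C \<longleftrightarrow> (\<exists>vs es. distinct vs \<and> set vs = C \<and>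
     distinct es \<and> set es = edges_within E C \<and> length vs = length es + 1 \<and>
     (\<forall>i<length es. snd (es ! i) = {vs ! i, vs ! (i + 1)}))"

(* As above, but closing up; a cycle of length 2 is a pair of parallel edges. *)
definition is_cycle :: "edge set \<Rightarrow> nat set \<Rightarrow> bool" where
  "is_cycle E C \<longleftrightarrow> (\<exists>vs es. vs \<noteq> [] \<and> distinct vs \<and> set vs = C \<and>
     distinct es \<and> set es = edges_within E C \<and> length vs = length es \<and>
     (\<forall>i<length es. snd (es ! i) = {vs ! i, vs ! ((i + 1) mod length vs)}))"

definition meander_index :: "nat list \<Rightarrow> nat list \<Rightarrow> nat" where
  "meander_index u l =
     (let V = {1..sum_list u}; E = meander_edges u l
      in 2 * card {C \<in> components V E. is_cycle E C} + card {C \<in> components V E. is_path E C})"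

definition meanders :: "nat \<Rightarrow> (nat list \<times> nat list) set" where
  "meanders n = {(u, l). composition n u \<and> composition n l}"

definition meander_count :: "nat set \<Rightarrow> nat \<Rightarrow> nat \<Rightarrow> nat" where
  "meander_count J n k =
     card {(u, l). (u, l) \<in> meanders n \<and> set u \<subseteq> J \<and> set l \<subseteq> J \<and> meander_index u l = k}"

(* Power series in x and y are power series in x (outer) over power series in y (inner).
   Coefficients are taken in rat, since the division of fps needs inverses of coefficients. *)
definition meander_gf :: "nat set \<Rightarrow> rat fps fps" where
  "meander_gf J = Abs_fps (\<lambda>n. Abs_fps (\<lambda>k. of_nat (meander_count J n k)))"

definition var_x :: "rat fps fps" where "var_x = fps_X"

definition var_y :: "rat fps fps" where "var_y = fps_const fps_X"

(* F(x^c, y^c); meaningful for c \<ge> 1, as fps_compose requires a vanishing constant term. *)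
definition subst_powers :: "nat \<Rightarrow> rat fps fps \<Rightarrow> rat fps fps" where
  "subst_powers c F =
     fps_compose (Abs_fps (\<lambda>n. fps_compose (fps_nth F n) (fps_X ^ c))) (fps_X ^ c)"

end

theory Submission
  imports Defs "HOL-Library.FuncSet"
begin

text \<open>
  Let \<open>\<sigma>\<close> and \<open>\<tau>\<close> be the involutions of the vertices given by the upper and the lower edges, an
  unmatched vertex being fixed. A colouring \<open>h\<close> with \<open>h \<circ> \<sigma> = h \<circ> \<tau>\<close> is constant on a path and
  alternates between two independent colours on a cycle, so with \<open>q\<close> colours there are \<open>q\<close> to the
  power of the index many of them. Written as words, they are the words on which reversing the
  blocks of the upper composition has the same effect as reversing those of the lower one.

  This turns the reductions of a meander at its left end into identities between short words. For
  the parts 1, 3, 4 they close up: let \<open>B\<^sub>p\<close> count the meanders whose lower composition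
  begins with the extra prefix \<open>p\<close>. Then, with \<open>A\<close> belonging to the empty prefix,
  \<open>A = 1 + (x y + x^3 y^3 + x^4 y^4) A + 2 x B\<^sub>1\<^sub>1 + 2 x B\<^sub>2\<^sub>1 + 2 x^3 B\<^sub>1\<close>,
  \<open>B\<^sub>1 = x y A + x B\<^sub>1\<^sub>1 + x B\<^sub>2\<^sub>1\<close>, \<open>B\<^sub>1\<^sub>1 = (x y + x^2 y) B\<^sub>1 + x^2 B\<^sub>1\<^sub>1\<close> and
  \<open>B\<^sub>2\<^sub>1 = x B\<^sub>1\<^sub>1 + x^3 y A + x^3 B\<^sub>1\<close>, and the first series is found by elimination.
  Taking words of length \<open>c\<close> as colours shows that dilating a meander by \<open>c\<close> multiplies its index
  by \<open>c\<close>.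
\<close>

section \<open>Colourings invariant under two involutions\<close>

fun other_side :: "side \<Rightarrow> side" where
  "other_side Upper = Lower"
| "other_side Lower = Upper"

lemma other_side_other_side [simp]: "other_side (other_side s) = s"
  by (cases s) auto

lemma side_eq_or_other: "t = s \<or> t = other_side s"
  by (cases s; cases t) auto

definition walk_side :: "side \<Rightarrow> nat \<Rightarrow> side" where
  "walk_side s i = (if even i then s else other_side s)"

lemma walk_side_Suc [simp]: "walk_side s (Suc i) = other_side (walk_side s i)"
  by (auto simp: walk_side_def)

lemma walk_side_0 [simp]: "walk_side s 0 = s"
  by (auto simp: walk_side_def)

lemma walk_side_eq_iff: "walk_side s i = walk_side s j \<longleftrightarrow> even i = even j"
  by (cases s) (auto simp: walk_side_def)

text \<open>Both notions count the same vertex set and the same edge set, but a path has one vertex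
  more than edges and a cycle equally many.\<close>

lemma not_path_and_cycle:
  assumes "is_path E C" "is_cycle E C"
  shows False
  using assms unfolding is_path_def is_cycle_def
  by (metis distinct_card add_eq_self_zero zero_neq_one)

text \<open>Unmatched vertices are encoded as fixed points, so each side acts as a total involution
  on \<open>V\<close> and the graph is recovered from the non-fixed points.\<close>

locale involution_pair =
  fixes V :: "nat set" and refl :: "side \<Rightarrow> nat \<Rightarrow> nat"
  assumes finite_V: "finite V"
    and refl_in: "v \<in> V \<Longrightarrow> refl s v \<in> V"
    and refl_refl: "v \<in> V \<Longrightarrow> refl s (refl s v) = v"
begin

definition edges :: "edge set" where
  "edges = {(s, {v, refl s v}) |s v. v \<in> V \<and> refl s v \<noteq> v}"

abbreviation comp :: "nat \<Rightarrow> nat set" where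
  "comp v \<equiv> (adjacency edges)\<^sup>* `` {v}"

definition invariant :: "nat set \<Rightarrow> bool" where
  "invariant C \<longleftrightarrow> C \<subseteq> V \<and> (\<forall>v\<in>C. \<forall>s. refl s v \<in> C)"

text \<open>Extensional functions make the set countable by \<open>card\<close>. The type of colours
  is left open: Boolean values serve for the reductions, Boolean lists for dilation.\<close>

definition colourings :: "'a set \<Rightarrow> nat set \<Rightarrow> (nat \<Rightarrow> 'a) set" where
  "colourings A C = {h \<in> C \<rightarrow>\<^sub>E A. \<forall>v\<in>C. h (refl Upper v) = h (refl Lower v)}"

text \<open>The walk follows the two involutions alternately. It runs along a component, stands still for
  one step exactly when it meets a fixed point, and then goes back the way it came.\<close>

primrec walk :: "side \<Rightarrow> nat \<Rightarrow> nat \<Rightarrow> nat" where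
  "walk s v 0 = v"
| "walk s v (Suc i) = refl (walk_side s i) (walk s v i)"

section \<open>Components of the graph of two involutions\<close>

lemma adjacency_edges:
  "(v, w) \<in> adjacency edges \<longleftrightarrow> v \<in> V \<and> w \<noteq> v \<and> (\<exists>s. w = refl s v)"
proof
  assume "(v, w) \<in> adjacency edges"
  then obtain s u where u: "u \<in> V" "refl s u \<noteq> u" "{u, refl s u} = {v, w}"
    unfolding adjacency_def edges_def by auto
  then consider "v = u" "w = refl s u" | "v = refl s u" "w = u"
    by (auto simp: doubleton_eq_iff)
  then show "v \<in> V \<and> w \<noteq> v \<and> (\<exists>s. w = refl s v)"
    using u refl_in refl_refl by cases metis+
next
  assume "v \<in> V \<and> w \<noteq> v \<and> (\<exists>s. w = refl s v)"
  then show "(v, w) \<in> adjacency edges"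
    unfolding adjacency_def edges_def by force
qed

lemma refl_in_comp:
  assumes "v \<in> V" "w \<in> comp v"
  shows "refl s w \<in> comp v"
proof -
  have "(v, w) \<in> (adjacency edges)\<^sup>*" using assms by auto
  then have "w \<in> V"
    using assms by (induction) (auto simp: adjacency_edges refl_in)
  then have "refl s w = w \<or> (w, refl s w) \<in> adjacency edges"
    by (auto simp: adjacency_edges)
  with assms show ?thesis by auto
qed

lemma comp_subset:
  assumes "invariant C" "v \<in> C"
  shows "comp v \<subseteq> C"
proof
  fix w assume "w \<in> comp v"
  then have "(v, w) \<in> (adjacency edges)\<^sup>*" by auto
  then show "w \<in> C"
    using assms by (induction) (auto simp: adjacency_edges invariant_def)
qed

lemma invariant_V: "invariant V"
  by (auto simp: invariant_def refl_in)

lemma invariant_comp: "v \<in> V \<Longrightarrow> invariant (comp v)"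
  using comp_subset[OF invariant_V, of v] refl_in_comp by (auto simp: invariant_def)

lemma comp_eq:
  assumes "v \<in> V" "w \<in> comp v"
  shows "comp w = comp v"
proof -
  have "sym (adjacency edges)"
    by (rule symI) (auto simp: adjacency_def insert_commute)
  then have "sym ((adjacency edges)\<^sup>*)" by (rule sym_rtrancl)
  moreover have "(v, w) \<in> (adjacency edges)\<^sup>*" using assms by auto
  ultimately have "(w, v) \<in> (adjacency edges)\<^sup>*" by (rule symD)
  with \<open>(v, w) \<in> _\<close> show ?thesis by auto
qed

lemma edges_within_invariant:
  assumes "invariant C"
  shows "edges_within edges C = {(s, {v, refl s v}) |s v. v \<in> C \<and> refl s v \<noteq> v}"
  using assms unfolding edges_within_def edges_def invariant_def by fastforce

lemma walk_in_comp: "v \<in> V \<Longrightarrow> walk s v i \<in> comp v"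
proof (induction i)
  case (Suc i)
  then show ?case unfolding walk.simps by (intro refl_in_comp) auto
qed simp

lemma comp_subset_V: "v \<in> V \<Longrightarrow> comp v \<subseteq> V"
  by (rule comp_subset[OF invariant_V])

lemma walk_in: "v \<in> V \<Longrightarrow> walk s v i \<in> V"
  using walk_in_comp comp_subset_V by blast

lemma walk_back: "v \<in> V \<Longrightarrow> refl (walk_side s i) (walk s v (Suc i)) = walk s v i"
  by (simp add: refl_refl walk_in)

text \<open>The walk never leaves the component, and an invariant set containing \<open>v\<close>
  contains the whole component. This identifies a component with an explicit list of
  vertices.\<close>

lemma comp_eq_walk:
  assumes "v \<in> V" "0 < m" "invariant (walk s v ` {..<m})"
  shows "comp v = walk s v ` {..<m}"
proof
  show "comp v \<subseteq> walk s v ` {..<m}"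
    by (rule comp_subset[OF assms(3)]) (use assms(2) in force)
  show "walk s v ` {..<m} \<subseteq> comp v"
    using walk_in_comp[OF assms(1)] by blast
qed

section \<open>Repetitions in the alternating walk\<close>

text \<open>At positions of equal parity the last step used the same side, so an equality can be
  undone step by step until the earlier position is the start.\<close>

lemma walk_eq_even:
  assumes "v \<in> V"
  shows "walk s v i = walk s v (i + 2 * d) \<Longrightarrow> walk s v (2 * d) = v"
proof (induction i)
  case (Suc i)
  have "walk_side s (i + 2 * d) = walk_side s i"
    by (simp add: walk_side_def)
  then have "walk s v i = walk s v (i + 2 * d)"
    using walk_back[OF assms, of s i] walk_back[OF assms, of s "i + 2 * d"] Suc.prems
    by (simp only: add_Suc)
  then show ?case by (rule Suc.IH)
qed auto

text \<open>Stepping forward from the first and backward from the second of two equal positions of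
  different parity keeps them equal, until they are adjacent.\<close>

lemma walk_eq_odd:
  assumes "v \<in> V"
  shows "walk s v i = walk s v (i + 2 * d + 1) \<Longrightarrow> walk s v (i + d) = walk s v (Suc (i + d))"
proof (induction d arbitrary: i)
  case (Suc d)
  have eq: "walk_side s (Suc (Suc (i + 2 * d))) = walk_side s i"
    by (simp add: walk_side_def)
  have "walk s v (Suc i) = refl (walk_side s i) (walk s v (Suc (Suc (Suc (i + 2 * d)))))"
    using Suc.prems by (simp add: numeral_eq_Suc)
  also have "\<dots> = walk s v (Suc (Suc (i + 2 * d)))"
    using walk_back[OF assms, of s "Suc (Suc (i + 2 * d))"] by (simp only: eq)
  finally have "walk s v (Suc i) = walk s v (Suc i + 2 * d + 1)"
    by simp
  from Suc.IH[OF this] show ?case by simp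
qed auto

lemma walk_repeats:
  assumes "v \<in> V"
  obtains i j where "i < j" "walk s v i = walk s v j"
proof -
  have "\<not> inj (walk s v)"
    using finite_subset[OF _ finite_V, of "range (walk s v)"] walk_in[OF assms]
      finite_imageD[of "walk s v" UNIV] by auto
  then obtain i j where "i \<noteq> j" "walk s v i = walk s v j"
    by (auto simp: inj_def)
  then show thesis using that[of i j] that[of j i] by (metis linorder_neqE_nat)
qed

section \<open>The shape and the colourings of a single component\<close>

text \<open>A fixed point is an end of its component, and the walk from it lists every vertex once
  before its first standstill at the other end. The fixed end and the equality of \<open>h\<close>
  at the two neighbours of each vertex then force \<open>h\<close> to be constant.\<close>

lemma component_with_fixed_point:
  assumes v: "v \<in> V" and fixed: "refl s' v = v"
  shows "is_path edges (comp v) \<and> card (colourings A (comp v)) = card A"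
proof -
  \<comment> \<open>Starting on the side opposite to the fixed one makes the walk leave
    \<open>v\<close> at once, unless \<open>v\<close> is isolated.\<close>
  define s where "s = other_side s'"
  define w where "w = walk s v"
  have w0: "w 0 = v" and wSuc: "w (Suc i) = refl (walk_side s i) (w i)" for i
    by (simp_all add: w_def)
  have retreat: "refl (walk_side s i) (w (Suc i)) = w i" for i
    unfolding w_def by (rule walk_back[OF v])
  have fix0: "refl (other_side s) (w 0) = w 0"
    by (simp add: s_def w0 fixed)
  \<comment> \<open>An odd gap contracts to a standstill halfway. An even gap gives a return to
    \<open>v\<close>; as the last step before it uses the side fixing \<open>v\<close>, the walk was
    at \<open>v\<close> one step earlier too, an odd gap from the start.\<close>
  have repeat: "\<exists>k<j. w k = w (Suc k)" if ij: "i < j" "w i = w j" for i j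
  proof (cases "even (j - i)")
    case True
    then obtain d where "j - i = 2 * d" by blast
    moreover from this obtain e where "d = Suc e"
      using ij by (cases d) auto
    ultimately have d: "j = i + 2 * Suc e"
      using that by simp
    then have "w (2 * Suc e) = v"
      using walk_eq_even[OF v, of s i "Suc e"] that by (simp only: w_def)
    then have "w (Suc (2 * e)) = v"
      using fix0 retreat[of "Suc (2 * e)"] by (simp add: walk_side_def w0)
    then have "w e = w (Suc e)"
      using walk_eq_odd[OF v, of s 0 e] by (simp add: w_def)
    moreover have "e < j" using d by simp
    ultimately show ?thesis by blast
  next
    case False
    then obtain d where "j - i = 2 * d + 1" by (rule oddE)
    then have d: "j = i + 2 * d + 1" using that by simp
    then have "w (i + d) = w (Suc (i + d))"
      using walk_eq_odd[OF v, of s i d] ij by (simp only: w_def)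
    moreover have "i + d < j" using d by simp
    ultimately show ?thesis by blast
  qed
  \<comment> \<open>The first standstill is the other end of the path; any coincidence up to it
    would produce an earlier one.\<close>
  define n where "n = (LEAST k. w k = w (Suc k))"
  obtain i0 j0 where "i0 < j0" "w i0 = w j0"
    using walk_repeats[OF v, of s] unfolding w_def by metis
  then have "\<exists>k. w k = w (Suc k)" using repeat by blast
  then have n: "w n = w (Suc n)"
    unfolding n_def by (rule LeastI_ex)
  have dist: "w i \<noteq> w j" if ij: "i < j" "j \<le> n" for i j
  proof
    assume "w i = w j"
    then obtain k where "k < j" "w k = w (Suc k)" using repeat ij by blast
    then have "n \<le> k" unfolding n_def by (intro Least_le)
    with \<open>k < j\<close> ij show False by simp
  qed
  have inj: "i = j" if "w i = w j" "i < Suc n" "j < Suc n" for i j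
    using that dist[of i j] dist[of j i] by (metis less_Suc_eq_le linorder_neqE_nat)
  \<comment> \<open>The full table of reflections: one side leads forward, or stays put at the far
    end, and the other leads back, or stays put at \<open>v\<close>.\<close>
  have nb: "refl t (w i) = (if t = walk_side s i then (if i = n then w n else w (Suc i))
      else (case i of 0 \<Rightarrow> w 0 | Suc k \<Rightarrow> w k))" for t i
  proof (cases "t = walk_side s i")
    case True
    moreover have "w (Suc i) = (if i = n then w n else w (Suc i))"
      using n by metis
    ultimately show ?thesis using wSuc[of i] by metis
  next
    case False
    then have t: "t = other_side (walk_side s i)" using side_eq_or_other by blast
    then show ?thesis using False retreat fix0 by (cases i) auto
  qed
  have inv: "invariant (w ` {..<Suc n})"
    unfolding invariant_def using walk_in[OF v, of s]
    by (auto simp: nb w_def[symmetric] split: nat.splits)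
  have comp: "comp v = w ` {..<Suc n}"
    unfolding w_def by (rule comp_eq_walk[OF v]) (use inv in \<open>auto simp: w_def\<close>)
  have within: "edges_within edges (comp v)
      = {(t, {w i, refl t (w i)}) |t i. i < Suc n \<and> refl t (w i) \<noteq> w i}"
    unfolding comp edges_within_invariant[OF inv] by auto
  define es where "es = map (\<lambda>i. (walk_side s i, {w i, w (Suc i)})) [0..<n]"
  have "distinct es"
    unfolding es_def distinct_map
  proof (intro conjI inj_onI)
    fix i j assume ij: "i \<in> set [0..<n]" "j \<in> set [0..<n]"
      and "(walk_side s i, {w i, w (Suc i)}) = (walk_side s j, {w j, w (Suc j)})"
    then have "w i = w j \<or> w i = w (Suc j) \<and> w (Suc i) = w j"
      by (auto simp: doubleton_eq_iff)
    then have "i = j \<or> i = Suc j \<and> Suc i = j"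
      using inj[of i j] inj[of i "Suc j"] inj[of "Suc i" j] ij by auto
    then show "i = j" by auto
  qed simp
  moreover have "set es = edges_within edges (comp v)"
  proof -
    have "(walk_side s i, {w i, w (Suc i)}) \<in> edges_within edges (comp v)" if "i < n" for i
    proof -
      have "w (Suc i) = refl (walk_side s i) (w i)" "w (Suc i) \<noteq> w i"
        using dist[of i "Suc i"] that by (auto simp: wSuc)
      then show ?thesis using that
        unfolding within by force
    qed
    moreover have "(t, {w i, refl t (w i)}) \<in> set es"
      if it: "i < Suc n" "refl t (w i) \<noteq> w i" for t i
    proof (cases "t = walk_side s i")
      case True
      then show ?thesis using that nb[of t i] by (cases "i = n") (auto simp: es_def)
    next
      case False
      then obtain k where k: "i = Suc k" using it nb[of t i] by (cases i) auto
      then have "t = walk_side s k" using False side_eq_or_other[of t "walk_side s k"] by simp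
      then show ?thesis using that k retreat[of k]
        by (auto simp: es_def insert_commute intro!: image_eqI[of _ _ k])
    qed
    ultimately show ?thesis
      unfolding within by (fastforce simp: es_def)
  qed
  moreover have "distinct (map w [0..<Suc n])"
    using inj by (auto simp: distinct_map inj_on_def simp del: upt_Suc)
  moreover have "set (map w [0..<Suc n]) = comp v"
    by (auto simp: comp simp del: upt_Suc)
  moreover have "\<forall>i<length es. snd (es ! i) = {map w [0..<Suc n] ! i, map w [0..<Suc n] ! (i + 1)}"
    by (auto simp: es_def simp del: upt_Suc)
  ultimately have "is_path edges (comp v)"
    unfolding is_path_def
    by (intro exI[of _ "map w [0..<Suc n]"] exI[of _ es]) (auto simp: es_def simp del: upt_Suc)
  moreover have "bij_betw (\<lambda>a. \<lambda>x\<in>comp v. a) A (colourings A (comp v))"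
  proof (rule bij_betwI[where g = "\<lambda>h. h v"])
    show "(\<lambda>a. \<lambda>x\<in>comp v. a) \<in> A \<rightarrow> colourings A (comp v)"
      using invariant_comp[OF v] by (auto simp: colourings_def invariant_def)
    show "(\<lambda>h. h v) \<in> colourings A (comp v) \<rightarrow> A"
      by (auto simp: colourings_def)
    show "(\<lambda>x\<in>comp v. a) v = a" for a by simp
    show "(\<lambda>x\<in>comp v. h v) = h" if h: "h \<in> colourings A (comp v)" for h
    proof -
      have same: "h (refl t u) = h (refl t' u)" if "u \<in> comp v" for t t' u
        using h that by (cases t; cases t') (auto simp: colourings_def)
      have "i \<le> n \<Longrightarrow> h (w i) = h v" for i
      proof (induction i rule: less_induct)
        case (less i)
        show ?case
        proof (cases i)
          case (Suc k)
          \<comment> \<open>The two reflections of \<open>w k\<close> are \<open>w (Suc k)\<close>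
            and \<open>w (k - 1)\<close>, the latter being \<open>w 0\<close> also for
            \<open>k = 0\<close>. So the colour is copied from an earlier vertex.\<close>
          have "h (w i) = h (refl (other_side (walk_side s k)) (w k))"
            unfolding Suc wSuc using less.prems Suc by (intro same) (auto simp: comp)
          also have "\<dots> = (case k of 0 \<Rightarrow> h (w 0) | Suc l \<Rightarrow> h (w l))"
            using retreat fix0 by (cases k) auto
          also have "\<dots> = h v"
            using less Suc by (auto split: nat.splits simp: w0)
          finally show ?thesis .
        qed (simp add: w0)
      qed
      then have const: "h x = h v" if "x \<in> comp v" for x using that by (auto simp: comp)
      have "h \<in> extensional (comp v)" using h by (auto simp: colourings_def PiE_def)
      then show ?thesis
        by (rule extensionalityI[OF restrict_extensional]) (metis const restrict_apply')
    qed
  qed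
  ultimately show ?thesis by (simp add: bij_betw_same_card)
qed

text \<open>Without fixed points the walk never stands still, so it closes up after an even number
  of steps. The colouring condition links vertices at distance two on this even cycle, which leaves
  one free colour for each parity class.\<close>

lemma component_without_fixed_point:
  assumes v: "v \<in> V" and free: "\<And>u t. u \<in> comp v \<Longrightarrow> refl t u \<noteq> u"
  shows "is_cycle edges (comp v) \<and> card (colourings A (comp v)) = card A ^ 2"
proof -
  define s where "s = Upper"
  define w where "w = walk s v"
  have w0: "w 0 = v" and wSuc: "w (Suc i) = refl (walk_side s i) (w i)" for i
    by (simp_all add: w_def)
  have retreat: "refl (walk_side s i) (w (Suc i)) = w i" for i
    unfolding w_def by (rule walk_back[OF v])
  have ne: "w i \<noteq> w (Suc i)" for i
    using free[OF walk_in_comp[OF v, of s i]] unfolding w_def walk.simps by metis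
  \<comment> \<open>An odd gap would contract to a standstill, which is excluded; so every
    repetition is a return to the start after an even number of steps.\<close>
  have repeat: "\<exists>d. j = i + 2 * d \<and> w (2 * d) = v" if ij: "i < j" "w i = w j" for i j
  proof (cases "even (j - i)")
    case True
    then obtain d where "j - i = 2 * d" by blast
    with that have d: "j = i + 2 * d" by simp
    then have "w (2 * d) = v"
      using walk_eq_even[OF v, of s i d] that by (simp only: w_def)
    then show ?thesis using d by auto
  next
    case False
    then obtain d where "j - i = 2 * d + 1" by (rule oddE)
    then have d: "j = i + 2 * d + 1" using that by simp
    then have "w (i + d) = w (Suc (i + d))"
      using walk_eq_odd[OF v, of s i d] that by (simp only: w_def)
    then show ?thesis using ne by metis
  qed
  \<comment> \<open>The time of the first return is the length of the cycle.\<close>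
  define m where "m = (LEAST m. 0 < m \<and> w m = v)"
  obtain i0 j0 where ij0: "i0 < j0" "w i0 = w j0"
    using walk_repeats[OF v, of s] unfolding w_def by metis
  then obtain d0 where "j0 = i0 + 2 * d0" "w (2 * d0) = v" using repeat by blast
  with ij0 have "0 < 2 * d0 \<and> w (2 * d0) = v" by simp
  then have m: "0 < m \<and> w m = v"
    unfolding m_def by (rule LeastI)
  obtain d where d: "m = 2 * d"
    using repeat[of 0 m] m w0 by auto
  with m have "even m" "2 \<le> m" by auto
  have dist: "w i \<noteq> w j" if ij: "i < j" "j < m" for i j
  proof
    assume "w i = w j"
    then obtain d where d: "j = i + 2 * d" "w (2 * d) = v" using repeat ij by blast
    then have "m \<le> 2 * d" unfolding m_def using ij by (intro Least_le) auto
    with d ij show False by simp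
  qed
  have inj: "i = j" if "w i = w j" "i < m" "j < m" for i j
    using that dist[of i j] dist[of j i] by (metis linorder_neqE_nat)
  define next_i where "next_i i = (if Suc i = m then 0 else Suc i)" for i
  define prev_i where "prev_i i = (if i = 0 then m - 1 else i - 1)" for i
  have nextp: "next_i i < m" "even (next_i i) \<longleftrightarrow> odd i" if "i < m" for i
    using that m \<open>even m\<close> by (auto simp: next_i_def)
  have w_next: "w (next_i i) = w (Suc i)" for i
    using m by (simp add: next_i_def w0)
  have prevp: "prev_i i < m" "even (prev_i i) \<longleftrightarrow> odd i" "next_i (prev_i i) = i" if "i < m" for i
    using that \<open>even m\<close> \<open>2 \<le> m\<close> by (auto simp: next_i_def prev_i_def)
  have nb: "refl t (w i) = w (if t = walk_side s i then next_i i else prev_i i)" if "i < m" for t i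
  proof (cases "t = walk_side s i")
    case True
    then show ?thesis using wSuc[of i] by (simp add: w_next)
  next
    case False
    then have "t = walk_side s (prev_i i)"
      using side_eq_or_other[of t "walk_side s i"] prevp(2)[OF that]
      by (cases s) (auto simp: walk_side_def)
    moreover have "w i = w (Suc (prev_i i))"
      using prevp(3)[OF that] w_next[of "prev_i i"] by simp
    ultimately show ?thesis using False retreat[of "prev_i i"] by simp
  qed
  have inv: "invariant (w ` {..<m})"
    unfolding invariant_def
  proof (intro conjI subsetI ballI allI)
    fix u t assume "u \<in> w ` {..<m}"
    then obtain i where i: "u = w i" "i < m" by auto
    then show "u \<in> V" using walk_in[OF v] by (simp add: w_def)
    show "refl t u \<in> w ` {..<m}"
      unfolding i(1) nb[OF i(2)] using nextp(1)[OF i(2)] prevp(1)[OF i(2)] by simp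
  qed
  have comp: "comp v = w ` {..<m}"
    unfolding w_def by (rule comp_eq_walk[OF v]) (use m inv in \<open>auto simp: w_def\<close>)
  have within: "edges_within edges (comp v)
      = {(t, {w i, refl t (w i)}) |t i. i < m \<and> refl t (w i) \<noteq> w i}"
    unfolding comp edges_within_invariant[OF inv] by auto
  define es where "es = map (\<lambda>i. (walk_side s i, {w i, w (next_i i)})) [0..<m]"
  have "distinct es"
    unfolding es_def distinct_map
  proof (intro conjI inj_onI)
    fix i j assume ij: "i \<in> set [0..<m]" "j \<in> set [0..<m]"
      and eq: "(walk_side s i, {w i, w (next_i i)}) = (walk_side s j, {w j, w (next_i j)})"
    \<comment> \<open>The side tag fixes the parity of the position while \<open>next_i\<close>
      flips it, so no edge is listed again from its other end. This also separates the two parallel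
      edges when \<open>m = 2\<close>.\<close>
    then have "even i = even j" by (simp add: walk_side_eq_iff)
    then have "i \<noteq> next_i j" using nextp(2)[of j] ij by auto
    then have "w i \<noteq> w (next_i j)" using inj nextp(1)[of j] ij by auto
    then have "w i = w j" using eq by (auto simp: doubleton_eq_iff)
    then show "i = j" using inj ij by auto
  qed simp
  moreover have "set es = edges_within edges (comp v)"
  proof -
    have "(walk_side s i, {w i, w (next_i i)}) \<in> edges_within edges (comp v)" if "i < m" for i
    proof -
      have "w (next_i i) = refl (walk_side s i) (w i)" "w (next_i i) \<noteq> w i"
        using ne[of i] nb[OF that] by (auto simp: w_next)
      then show ?thesis using that
        unfolding within by force
    qed
    moreover have "(t, {w i, refl t (w i)}) \<in> set es" if i: "i < m" for t i
    proof (cases "t = walk_side s i")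
      case True
      then show ?thesis using i nb[of i t] by (auto simp: es_def)
    next
      case False
      then have "t = walk_side s (prev_i i)"
        using side_eq_or_other[of t "walk_side s i"] prevp(2)[OF i]
        by (cases s) (auto simp: walk_side_def)
      then show ?thesis using False nb[OF i, of t] prevp[OF i]
        by (auto simp: es_def insert_commute intro!: image_eqI[of _ _ "prev_i i"])
    qed
    ultimately show ?thesis
      unfolding within by (fastforce simp: es_def)
  qed
  moreover have "distinct (map w [0..<m])"
    using inj by (auto simp: distinct_map inj_on_def)
  moreover have "set (map w [0..<m]) = comp v"
    by (auto simp: comp)
  moreover have "snd (es ! i) = {map w [0..<m] ! i, map w [0..<m] ! ((i + 1) mod length (map w [0..<m]))}"
    if "i < length es" for i
  proof -
    have "next_i i = Suc i mod m" "Suc i mod m < m"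
      using that m by (auto simp: next_i_def es_def)
    then show ?thesis using that by (simp add: es_def)
  qed
  moreover have "map w [0..<m] \<noteq> []" "length (map w [0..<m]) = length es"
    using m by (auto simp: es_def)
  ultimately have cycle: "is_cycle edges (comp v)"
    unfolding is_cycle_def by blast
  \<comment> \<open>The parity class of \<open>w 0\<close>. The class is consistent around the cycle
    because \<open>m\<close> is even, and \<open>w 1\<close> represents the other class because
    \<open>m\<close> is at least 2.\<close>
  define P where "P x \<longleftrightarrow> (\<exists>i<m. even i \<and> x = w i)" for x
  have "bij_betw (\<lambda>(a, b). \<lambda>x\<in>comp v. if P x then a else b)
      (A \<times> A) (colourings A (comp v))"
  proof (rule bij_betwI[where g = "\<lambda>h. (h (w 0), h (w 1))"])
    have ev: "P (w j) \<longleftrightarrow> even j" if "j < m" for j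
      using inj that unfolding P_def by blast
    have ev': "P (refl t (w j)) \<longleftrightarrow> odd j" if "j < m" for j t
      unfolding nb[OF that] using ev nextp[OF that] prevp[OF that] by simp
    have w1: "w 0 \<in> comp v" "w 1 \<in> comp v"
      using \<open>2 \<le> m\<close> by (auto simp: comp)
    show "(\<lambda>(a, b). \<lambda>x\<in>comp v. if P x then a else b)
        \<in> A \<times> A \<rightarrow> colourings A (comp v)"
    proof
      fix p assume "p \<in> A \<times> A"
      then obtain a b where p: "p = (a, b)" and ab: "a \<in> A" "b \<in> A" by auto
      let ?h = "\<lambda>x\<in>comp v. if P x then a else b"
      have "?h (refl Upper u) = ?h (refl Lower u)" if u: "u \<in> comp v" for u
      proof -
        obtain j where "u = w j" "j < m" using u by (auto simp: comp)
        then have "?h (refl t u) = (if odd j then a else b)" for t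
          using ev'[of j t] refl_in_comp[OF v u, of t] by simp
        then show ?thesis by simp
      qed
      moreover have "?h \<in> comp v \<rightarrow>\<^sub>E A" using ab by auto
      ultimately have "?h \<in> colourings A (comp v)"
        unfolding colourings_def by blast
      then show "(case p of (a, b) \<Rightarrow> \<lambda>x\<in>comp v. if P x then a else b)
          \<in> colourings A (comp v)"
        by (simp add: p)
    qed
    show "(\<lambda>h. (h (w 0), h (w 1))) \<in> colourings A (comp v) \<rightarrow> A \<times> A"
      using w1 by (auto simp: colourings_def)
    show "(\<lambda>h. (h (w 0), h (w 1)))
        ((\<lambda>(a, b). \<lambda>x\<in>comp v. if P x then a else b) ab) = ab" for ab
      using w1 ev[of 0] ev[of 1] \<open>2 \<le> m\<close> by (cases ab) (auto simp: restrict_def)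
    show "(\<lambda>(a, b). \<lambda>x\<in>comp v. if P x then a else b) (h (w 0), h (w 1)) = h"
      if h: "h \<in> colourings A (comp v)" for h
    proof -
      have same: "h (refl t u) = h (refl t' u)" if "u \<in> comp v" for t t' u
        using h that by (cases t; cases t') (auto simp: colourings_def)
      have vals: "i < m \<Longrightarrow> h (w i) = (if even i then h (w 0) else h (w 1))" for i
      proof (induction i rule: less_induct)
        case (less i)
        consider "i = 0" | "i = 1" | k where "i = Suc (Suc k)"
          by (cases i; cases "i - 1") auto
        then show ?case
        proof cases
          case k: 3
          have "h (w i) = h (refl (walk_side s k) (w (Suc k)))"
            unfolding k wSuc[of "Suc k"] using less.prems k by (intro same) (auto simp: comp)
          also have "\<dots> = h (w k)" by (simp only: retreat)
          finally show ?thesis using less.IH[of k] less.prems k by simp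
        qed auto
      qed
      have const: "h x = (if P x then h (w 0) else h (w 1))" if x: "x \<in> comp v" for x
      proof -
        obtain i where i: "x = w i" "i < m" using x by (auto simp: comp)
        show ?thesis unfolding i(1) ev[OF i(2)] by (rule vals[OF i(2)])
      qed
      have "h \<in> extensional (comp v)" using h by (auto simp: colourings_def PiE_def)
      then show ?thesis
        unfolding prod.case
        by (rule extensionalityI[OF restrict_extensional]) (simp only: restrict_apply', rule const[symmetric])
    qed
  qed
  from bij_betw_same_card[OF this] show ?thesis
    using cycle by (simp add: card_cartesian_product power2_eq_square)
qed

text \<open>If the component contains any fixed point, that vertex can serve as its base, since all
  vertices of a component have the same component.\<close>

lemma component_dichotomy:
  assumes "C \<in> components V edges"
  shows "is_cycle edges C \<and> \<not> is_path edges C \<and> card (colourings A C) = card A ^ 2 \<or>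
    is_path edges C \<and> \<not> is_cycle edges C \<and> card (colourings A C) = card A"
proof -
  obtain v where v: "v \<in> V" "C = comp v"
    using assms by (auto simp: components_def)
  show ?thesis
  proof (cases "\<exists>u\<in>C. \<exists>t. refl t u = u")
    case True
    then obtain u t where u: "u \<in> C" "refl t u = u" by blast
    then have "u \<in> V" "comp u = C" using v comp_subset_V comp_eq by blast+
    then show ?thesis
      using component_with_fixed_point[OF _ u(2)] not_path_and_cycle by metis
  next
    case False
    then show ?thesis
      using component_without_fixed_point[OF v(1)] not_path_and_cycle v(2) by metis
  qed
qed

section \<open>Multiplicativity over the components\<close>

text \<open>The condition at a vertex concerns only its two reflections, which lie in the same
  invariant set; colourings of disjoint invariant sets are therefore chosen independently.\<close>

lemma card_colourings_Un:
  assumes "invariant C" "invariant D" "C \<inter> D = {}"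
  shows "card (colourings A (C \<union> D)) = card (colourings A C) * card (colourings A D)"
proof -
  have "bij_betw (\<lambda>h. (restrict h C, restrict h D)) (colourings A (C \<union> D))
      (colourings A C \<times> colourings A D)"
  proof (rule bij_betwI[where g = "\<lambda>(f, g). \<lambda>x\<in>C \<union> D. if x \<in> C then f x else g x"])
    show "(\<lambda>h. (restrict h C, restrict h D)) \<in> colourings A (C \<union> D) \<rightarrow> colourings A C \<times> colourings A D"
      using assms by (auto simp: colourings_def invariant_def)
    show "(\<lambda>(f, g). \<lambda>x\<in>C \<union> D. if x \<in> C then f x else g x)
        \<in> colourings A C \<times> colourings A D \<rightarrow> colourings A (C \<union> D)"
    proof
      fix p assume "p \<in> colourings A C \<times> colourings A D"
      then obtain f g where p: "p = (f, g)" and f: "f \<in> colourings A C" and g: "g \<in> colourings A D"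
        by auto
      let ?h = "\<lambda>x\<in>C \<union> D. if x \<in> C then f x else g x"
      have "?h (refl Upper v) = ?h (refl Lower v)" if "v \<in> C \<union> D" for v
      proof (cases "v \<in> C")
        case True
        then have "refl t v \<in> C" for t using assms by (auto simp: invariant_def)
        then show ?thesis using f True by (simp add: colourings_def)
      next
        case False
        then have "refl t v \<in> D" "refl t v \<notin> C" for t
          using that assms by (auto simp: invariant_def)
        then show ?thesis using g that False by (simp add: colourings_def)
      qed
      moreover have "?h \<in> C \<union> D \<rightarrow>\<^sub>E A"
        using f g by (auto simp: colourings_def)
      ultimately have "?h \<in> colourings A (C \<union> D)"
        unfolding colourings_def by blast
      then show "(case p of (f, g) \<Rightarrow> \<lambda>x\<in>C \<union> D. if x \<in> C then f x else g x) \<in> colourings A (C \<union> D)"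
        by (simp add: p)
    qed
    show "(\<lambda>(f, g). \<lambda>x\<in>C \<union> D. if x \<in> C then f x else g x) (restrict h C, restrict h D) = h"
      if "h \<in> colourings A (C \<union> D)" for h
      using that by (intro ext) (auto simp: colourings_def PiE_def extensional_def)
    show "(\<lambda>h. (restrict h C, restrict h D))
        ((\<lambda>(f, g). \<lambda>x\<in>C \<union> D. if x \<in> C then f x else g x) p) = p"
      if pin: "p \<in> colourings A C \<times> colourings A D" for p
    proof -
      obtain f g where p: "p = (f, g)" "f \<in> extensional C" "g \<in> extensional D"
        using pin by (auto simp: colourings_def PiE_def)
      have not_C: "x \<notin> C" if "x \<in> D" for x
        using that assms(3) by blast
      let ?h = "\<lambda>x\<in>C \<union> D. if x \<in> C then f x else g x"
      have "restrict ?h C = f"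
        by (rule extensionalityI[OF restrict_extensional p(2)]) (simp only: restrict_apply', simp)
      moreover have "restrict ?h D = g"
        by (rule extensionalityI[OF restrict_extensional p(3)]) (simp add: not_C)
      ultimately show ?thesis by (simp add: p(1))
    qed
  qed
  from bij_betw_same_card[OF this] show ?thesis
    by (simp add: card_cartesian_product)
qed

lemma card_colourings_Union:
  assumes "finite P" "\<And>C. C \<in> P \<Longrightarrow> invariant C"
    "\<And>C D. C \<in> P \<Longrightarrow> D \<in> P \<Longrightarrow> C \<noteq> D \<Longrightarrow> C \<inter> D = {}"
  shows "card (colourings A (\<Union>P)) = (\<Prod>C\<in>P. card (colourings A C))"
  using assms
proof (induction P)
  case empty
  show ?case by (simp add: colourings_def)
next
  case (insert C P)
  have "invariant D" if "D \<in> P" for D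
    using insert.prems(1) that by simp
  then have "invariant (\<Union>P)"
    unfolding invariant_def by blast
  moreover have "invariant C" using insert.prems(1) by simp
  moreover have "C \<inter> \<Union>P = {}"
    using insert.prems(2)[of C] insert.hyps by blast
  ultimately have "card (colourings A (C \<union> \<Union>P)) = card (colourings A C) * card (colourings A (\<Union>P))"
    by (intro card_colourings_Un)
  also have "card (colourings A (\<Union>P)) = (\<Prod>C\<in>P. card (colourings A C))"
    using insert.prems by (intro insert.IH) simp_all
  finally show ?case using insert.hyps by simp
qed

text \<open>Each cycle contributes a factor \<open>card A ^ 2\<close> and each path a factor
  \<open>card A\<close>, so the exponent is the weighting of cycles and paths used in the
  index.\<close>

lemma card_colourings:
  "card (colourings A V) = card A ^ (2 * card {C \<in> components V edges. is_cycle edges C}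
    + card {C \<in> components V edges. is_path edges C})"
proof -
  let ?P = "components V edges"
  have fin: "finite ?P" using finite_V by (simp add: components_def)
  have "\<Union>?P = V"
    using comp_subset_V unfolding components_def by blast
  moreover have "C \<inter> D = {}" if "C \<in> ?P" "D \<in> ?P" "C \<noteq> D" for C D
  proof (rule ccontr)
    assume "C \<inter> D \<noteq> {}"
    then obtain u where "u \<in> C" "u \<in> D" by blast
    then have "comp u = C" "comp u = D"
      using that comp_eq by (auto simp: components_def simp del: Image_singleton_iff)
    with that show False by simp
  qed
  moreover have "invariant C" if "C \<in> ?P" for C
    using that invariant_comp by (auto simp: components_def)
  ultimately have "card (colourings A V) = (\<Prod>C\<in>?P. card (colourings A C))"
    using card_colourings_Union[OF fin] by metis
  also have "\<dots> = (\<Prod>C\<in>{C \<in> ?P. is_cycle edges C} \<union> {C \<in> ?P. is_path edges C}. card (colourings A C))"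
    by (intro prod.cong) (use component_dichotomy in auto)
  also have "\<dots> = (\<Prod>C\<in>{C \<in> ?P. is_cycle edges C}. card (colourings A C))
      * (\<Prod>C\<in>{C \<in> ?P. is_path edges C}. card (colourings A C))"
    using fin not_path_and_cycle by (intro prod.union_disjoint) auto
  also have "(\<Prod>C\<in>{C \<in> ?P. is_cycle edges C}. card (colourings A C))
      = (\<Prod>C\<in>{C \<in> ?P. is_cycle edges C}. card A ^ 2)"
    using component_dichotomy by (intro prod.cong) auto
  also have "(\<Prod>C\<in>{C \<in> ?P. is_path edges C}. card (colourings A C))
      = (\<Prod>C\<in>{C \<in> ?P. is_path edges C}. card A)"
    using component_dichotomy by (intro prod.cong) auto
  finally show ?thesis by (simp add: power_add power_mult)
qed

end

section \<open>Symmetric words\<close>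

text \<open>Positions count from 0, whereas the vertices of a meander count from 1. Positions beyond
  the last block are fixed, which makes this an involution on all natural numbers.\<close>

primrec block_refl :: "nat list \<Rightarrow> nat \<Rightarrow> nat" where
  "block_refl [] i = i"
| "block_refl (a # u) i = (if i < a then a - 1 - i else a + block_refl u (i - a))"

primrec block_rev :: "nat list \<Rightarrow> 'a list \<Rightarrow> 'a list" where
  "block_rev [] h = h"
| "block_rev (a # u) h = rev (take a h) @ block_rev u (drop a h)"

lemma block_refl_less: "i < sum_list u \<Longrightarrow> block_refl u i < sum_list u"
  by (induction u arbitrary: i) (auto simp: less_diff_conv2)

lemma block_refl_block_refl: "block_refl u (block_refl u i) = i"
  by (induction u arbitrary: i) auto

lemma length_block_rev [simp]: "length (block_rev u h) = length h"
  by (induction u arbitrary: h) auto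

lemma nth_block_rev:
  "sum_list u = length h \<Longrightarrow> i < length h \<Longrightarrow> block_rev u h ! i = h ! block_refl u i"
proof (induction u arbitrary: h i)
  case (Cons a u)
  then have "block_rev u (drop a h) ! (i - a) = drop a h ! block_refl u (i - a)" if "a \<le> i"
    using that by (intro Cons.IH) auto
  then show ?case
    using Cons.prems by (auto simp: nth_append rev_nth)
qed simp

section \<open>From arcs to block reflections\<close>

lemma arcs_Cons:
  "arcs (a # u) = {{i, a + 1 - i} |i. 1 \<le> i \<and> i \<le> a div 2} \<union> image ((+) a) ` arcs u"
proof (intro set_eqI iffI)
  fix e assume "e \<in> arcs (a # u)"
  then obtain i j where e: "j < length (a # u)" "1 \<le> i" "i \<le> (a # u) ! j div 2"
      "e = {sum_list (take j (a # u)) + i, sum_list (take j (a # u)) + (a # u) ! j + 1 - i}"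
    unfolding arcs_def by blast
  show "e \<in> {{i, a + 1 - i} |i. 1 \<le> i \<and> i \<le> a div 2} \<union> image ((+) a) ` arcs u"
  proof (cases j)
    case 0
    then show ?thesis using e by auto
  next
    case (Suc k)
    let ?e = "{sum_list (take k u) + i, sum_list (take k u) + u ! k + 1 - i}"
    have "?e \<in> arcs u" using e Suc unfolding arcs_def by auto
    moreover have "e = (+) a ` ?e" using e Suc by auto
    ultimately show ?thesis by blast
  qed
next
  fix e assume "e \<in> {{i, a + 1 - i} |i. 1 \<le> i \<and> i \<le> a div 2} \<union> image ((+) a) ` arcs u"
  then show "e \<in> arcs (a # u)"
  proof
    assume "e \<in> {{i, a + 1 - i} |i. 1 \<le> i \<and> i \<le> a div 2}"
    then obtain i where "e = {i, a + 1 - i}" "1 \<le> i" "i \<le> a div 2" by blast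
    then show ?thesis
      unfolding arcs_def by (intro CollectI exI[of _ 0] exI[of _ i] exI[of _ 0]) simp
  next
    assume "e \<in> image ((+) a) ` arcs u"
    then obtain i k where e: "k < length u" "1 \<le> i" "i \<le> u ! k div 2"
        "e = (+) a ` {sum_list (take k u) + i, sum_list (take k u) + u ! k + 1 - i}"
      unfolding arcs_def by blast
    then have "a + (sum_list (take k u) + u ! k + 1 - i) = a + sum_list (take k u) + u ! k + 1 - i"
      by simp
    with e show ?thesis
      unfolding arcs_def
      by (intro CollectI exI[of _ "a + sum_list (take k u)"] exI[of _ i] exI[of _ "Suc k"])
        (simp add: add.assoc)
  qed
qed

text \<open>The definition of \<open>arcs\<close> names an edge by its left end only, the right side
  here by either end. The condition that \<open>i\<close> is not fixed removes the middle of an odd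
  block.\<close>

lemma arcs_eq: "arcs u = {{Suc i, Suc (block_refl u i)} |i. i < sum_list u \<and> block_refl u i \<noteq> i}"
proof (induction u)
  case Nil
  show ?case by (simp add: arcs_def)
next
  case (Cons a u)
  have "{{i, a + 1 - i} |i. 1 \<le> i \<and> i \<le> a div 2} = {{Suc i, Suc (a - 1 - i)} |i. i < a \<and> a - 1 - i \<noteq> i}"
    (is "?L = ?R")
  proof (intro set_eqI iffI)
    fix e assume "e \<in> ?L"
    then obtain i where "1 \<le> i" "i \<le> a div 2" "e = {i, a + 1 - i}" by blast
    then show "e \<in> ?R" by (intro CollectI exI[of _ "i - 1"]) auto
  next
    fix e assume "e \<in> ?R"
    then obtain i where i: "i < a" "a - 1 - i \<noteq> i" "e = {Suc i, Suc (a - 1 - i)}" by blast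
    then consider "Suc i \<le> a div 2" | "a - i \<le> a div 2" by linarith
    then show "e \<in> ?L"
    proof cases
      case 1
      then show ?thesis using i by (intro CollectI exI[of _ "Suc i"]) auto
    next
      case 2
      then show ?thesis using i by (intro CollectI exI[of _ "a - i"]) (auto simp: insert_commute)
    qed
  qed
  moreover have "image ((+) a) ` {{Suc i, Suc (block_refl u i)} |i. i < sum_list u \<and> block_refl u i \<noteq> i}
      = {{Suc i, Suc (a + block_refl u (i - a))} |i. a \<le> i \<and> i < a + sum_list u \<and> a + block_refl u (i - a) \<noteq> i}"
    (is "?L' = ?R'")
  proof (intro set_eqI iffI)
    fix e assume "e \<in> ?L'"
    then obtain i where "i < sum_list u" "block_refl u i \<noteq> i" "e = (+) a ` {Suc i, Suc (block_refl u i)}"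
      by blast
    then show "e \<in> ?R'" by (intro CollectI exI[of _ "a + i"]) auto
  next
    fix e assume "e \<in> ?R'"
    then obtain i where i: "a \<le> i" "i < a + sum_list u" "a + block_refl u (i - a) \<noteq> i"
        "e = {Suc i, Suc (a + block_refl u (i - a))}" by blast
    then have "e = (+) a ` {Suc (i - a), Suc (block_refl u (i - a))}" by auto
    moreover have "i - a < sum_list u" "block_refl u (i - a) \<noteq> i - a" using i by auto
    ultimately show "e \<in> ?L'" by blast
  qed
  moreover have "{{Suc i, Suc (block_refl (a # u) i)} |i. i < sum_list (a # u) \<and> block_refl (a # u) i \<noteq> i}
    = {{Suc i, Suc (a - 1 - i)} |i. i < a \<and> a - 1 - i \<noteq> i} \<union>
      {{Suc i, Suc (a + block_refl u (i - a))} |i. a \<le> i \<and> i < a + sum_list u \<and> a + block_refl u (i - a) \<noteq> i}"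
    (is "?X = ?Y \<union> ?Z")
  proof (intro set_eqI iffI)
    fix e assume "e \<in> ?X"
    then obtain i where i: "i < sum_list (a # u)" "block_refl (a # u) i \<noteq> i"
        "e = {Suc i, Suc (block_refl (a # u) i)}" by blast
    show "e \<in> ?Y \<union> ?Z"
    proof (cases "i < a")
      case True
      with i have "e \<in> ?Y" by auto
      then show ?thesis by blast
    next
      case False
      with i have "e \<in> ?Z" by auto
      then show ?thesis by blast
    qed
  next
    fix e assume "e \<in> ?Y \<union> ?Z"
    then show "e \<in> ?X"
    proof
      assume "e \<in> ?Y"
      then obtain i where "i < a" "a - 1 - i \<noteq> i" "e = {Suc i, Suc (a - 1 - i)}" by blast
      then show ?thesis by (intro CollectI exI[of _ i]) simp
    next
      assume "e \<in> ?Z"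
      then obtain i where "a \<le> i" "i < a + sum_list u" "a + block_refl u (i - a) \<noteq> i"
        "e = {Suc i, Suc (a + block_refl u (i - a))}" by blast
      then show ?thesis by (intro CollectI exI[of _ i]) simp
    qed
  qed
  ultimately show ?case by (simp only: arcs_Cons Cons.IH)
qed

text \<open>A word is a colouring of the vertices, the letter at position \<open>i\<close> colouring
  vertex \<open>i + 1\<close>. Comparing the two block reversals letter by letter is exactly the
  colouring condition.\<close>

lemma card_symmetric_words:
  assumes sum: "sum_list u = sum_list l"
  shows "card {h. length h = sum_list u \<and> set h \<subseteq> A \<and> block_rev u h = block_rev l h}
    = card A ^ meander_index u l" (is "card ?H = _")
proof -
  define n where "n = sum_list u"
  define blocks where "blocks s = (case s of Upper \<Rightarrow> u | Lower \<Rightarrow> l)" for s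
  define refl where "refl s v = Suc (block_refl (blocks s) (v - 1))" for s v
  have sum_blocks: "sum_list (blocks s) = n" for s
    using sum by (cases s) (auto simp: blocks_def n_def)
  interpret involution_pair "{1..n}" refl
  proof
    fix v s assume v: "v \<in> {1..n}"
    then have "v - 1 < sum_list (blocks s)" by (auto simp: sum_blocks)
    then have "block_refl (blocks s) (v - 1) < n"
      using block_refl_less by (metis sum_blocks)
    then show "refl s v \<in> {1..n}" by (simp add: refl_def)
    show "refl s (refl s v) = v" using v by (simp add: refl_def block_refl_block_refl)
  qed simp
  have arcs_blocks: "arcs (blocks s) = {{v, refl s v} |v. v \<in> {1..n} \<and> refl s v \<noteq> v}" for s
  proof (intro set_eqI iffI)
    fix e assume "e \<in> arcs (blocks s)"
    then obtain i where "i < n" "block_refl (blocks s) i \<noteq> i" "e = {Suc i, Suc (block_refl (blocks s) i)}"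
      unfolding arcs_eq sum_blocks by blast
    then show "e \<in> {{v, refl s v} |v. v \<in> {1..n} \<and> refl s v \<noteq> v}"
      by (intro CollectI exI[of _ "Suc i"]) (simp add: refl_def)
  next
    fix e assume "e \<in> {{v, refl s v} |v. v \<in> {1..n} \<and> refl s v \<noteq> v}"
    then obtain v where "v \<in> {1..n}" "refl s v \<noteq> v" "e = {v, refl s v}" by blast
    then show "e \<in> arcs (blocks s)"
      unfolding arcs_eq sum_blocks by (intro CollectI exI[of _ "v - 1"]) (auto simp: refl_def)
  qed
  have "(s, d) \<in> meander_edges u l \<longleftrightarrow> d \<in> arcs (blocks s)" for s d
    by (cases s) (auto simp: meander_edges_def blocks_def)
  then have edges_eq: "meander_edges u l = edges"
    unfolding edges_def arcs_blocks by auto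
  have "bij_betw (\<lambda>h. \<lambda>v\<in>{1..n}. h ! (v - 1)) ?H (colourings A {1..n})"
  proof (rule bij_betwI[where g = "\<lambda>f. map (\<lambda>i. f (Suc i)) [0..<n]"])
    show "(\<lambda>h. \<lambda>v\<in>{1..n}. h ! (v - 1)) \<in> ?H \<rightarrow> colourings A {1..n}"
    proof
      fix h assume h: "h \<in> ?H"
      have "h ! (refl Upper v - 1) = h ! (refl Lower v - 1)" if v: "v \<in> {1..n}" for v
      proof -
        have "block_rev u h ! (v - 1) = block_rev l h ! (v - 1)" using h by simp
        moreover have "length h = n" "v - 1 < length h" using h v by (auto simp: n_def)
        ultimately show ?thesis
          using nth_block_rev[of u h "v - 1"] nth_block_rev[of l h "v - 1"] sum_blocks[of Upper]
            sum_blocks[of Lower] by (simp add: refl_def blocks_def)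
      qed
      moreover have "h ! (v - 1) \<in> A" if "v \<in> {1..n}" for v
        using h that nth_mem[of "v - 1" h] by (auto simp: n_def)
      ultimately show "(\<lambda>v\<in>{1..n}. h ! (v - 1)) \<in> colourings A {1..n}"
        using refl_in by (auto simp: colourings_def)
    qed
    show "(\<lambda>f. map (\<lambda>i. f (Suc i)) [0..<n]) \<in> colourings A {1..n} \<rightarrow> ?H"
    proof
      fix f assume f: "f \<in> colourings A {1..n}"
      let ?h = "map (\<lambda>i. f (Suc i)) [0..<n]"
      have nth: "block_rev (blocks s) ?h ! i = f (refl s (Suc i))" if "i < n" for s i
        using that block_refl_less[of i "blocks s"]
        by (simp add: nth_block_rev sum_blocks refl_def)
      have "block_rev u ?h = block_rev l ?h"
      proof (rule nth_equalityI)
        fix i assume "i < length (block_rev u ?h)"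
        then have "i < n" by simp
        then show "block_rev u ?h ! i = block_rev l ?h ! i"
          using nth[of i Upper] nth[of i Lower] f by (simp add: blocks_def colourings_def)
      qed simp
      then show "?h \<in> ?H" using f by (auto simp: n_def colourings_def)
    qed
    show "map (\<lambda>i. (\<lambda>v\<in>{1..n}. h ! (v - 1)) (Suc i)) [0..<n] = h" if "h \<in> ?H" for h
      using that by (intro nth_equalityI) (auto simp: n_def)
    show "(\<lambda>v\<in>{1..n}. map (\<lambda>i. f (Suc i)) [0..<n] ! (v - 1)) = f" if "f \<in> colourings A {1..n}" for f
    proof (rule extensionalityI[OF restrict_extensional])
      show "f \<in> extensional {1..n}" using that by (auto simp: colourings_def PiE_def)
    qed auto
  qed
  from bij_betw_same_card[OF this] show ?thesis
    unfolding card_colourings by (simp only: meander_index_def edges_eq n_def Let_def)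
qed

section \<open>Reductions of the index\<close>

text \<open>Two letters suffice to recover the index, since a power of 2 determines its
  exponent.\<close>

definition symmetric_words :: "nat list \<Rightarrow> nat list \<Rightarrow> bool list set" where
  "symmetric_words u l = {h. length h = sum_list u \<and> block_rev u h = block_rev l h}"

lemma card_symmetric_bool_words:
  "sum_list u = sum_list l \<Longrightarrow> card (symmetric_words u l) = 2 ^ meander_index u l"
  using card_symmetric_words[of u l "UNIV :: bool set"] by (simp add: symmetric_words_def)

lemma meander_index_commute:
  assumes "sum_list u = sum_list l"
  shows "meander_index u l = meander_index l u"
proof -
  have "symmetric_words u l = symmetric_words l u"
    using assms by (auto simp: symmetric_words_def)
  then have "(2::nat) ^ meander_index u l = 2 ^ meander_index l u"
    using assms by (metis card_symmetric_bool_words)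
  then show ?thesis by simp
qed

text \<open>Counting both sides gives an equation between powers of 2. A bijection of words thus
  replaces any tracking of components; \<open>k\<close> is the number of letters that are
  free.\<close>

lemma meander_index_add:
  assumes sum: "sum_list u = sum_list l" "sum_list u' = sum_list l'"
    and bij: "bij_betw f ({b :: bool list. length b = k} \<times> symmetric_words u' l') (symmetric_words u l)"
  shows "meander_index u l = k + meander_index u' l'"
proof -
  have "card {b :: bool list. length b = k} = 2 ^ k"
    using card_lists_length_eq[of "UNIV :: bool set" k] by simp
  then have "(2::nat) ^ meander_index u l = 2 ^ (k + meander_index u' l')"
    using bij_betw_same_card[OF bij] sum
    by (simp add: card_cartesian_product card_symmetric_bool_words power_add)
  then show ?thesis by simp
qed

lemma meander_index_eq:
  assumes "sum_list u = sum_list l" "sum_list u' = sum_list l'"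
    and "bij_betw f (symmetric_words u' l') (symmetric_words u l)"
  shows "meander_index u l = meander_index u' l'"
proof -
  have "(2::nat) ^ meander_index u l = 2 ^ meander_index u' l'"
    using bij_betw_same_card[OF assms(3)] assms(1,2) by (simp add: card_symmetric_bool_words)
  then show ?thesis by simp
qed

text \<open>In each of the following reductions the symmetry condition at the first positions expresses
  the deleted letters through the remaining ones, or leaves one of them free; each free letter
  doubles the number of words and so raises the index by one.\<close>

lemma meander_index_Cons_same:
  assumes "sum_list u = sum_list l"
  shows "meander_index (a # u) (a # l) = a + meander_index u l"
proof (rule meander_index_add[OF _ assms])
  show "bij_betw (\<lambda>(b, h). b @ h) ({b. length b = a} \<times> symmetric_words u l)
      (symmetric_words (a # u) (a # l))"
    by (rule bij_betwI[where g = "\<lambda>h. (take a h, drop a h)"])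
      (auto simp: symmetric_words_def)
qed (use assms in simp)

lemma meander_index_1_3:
  assumes "sum_list u = 2 + sum_list l"
  shows "meander_index (1 # u) (3 # l) = meander_index u (1 # 1 # l)"
proof (rule meander_index_eq)
  \<comment> \<open>For a word \<open>x0 x1 x2 ...\<close> the first position demands
    \<open>x0 = x2\<close>, which is letter 1 once \<open>x0\<close> is deleted. Substituting it
    turns the reversed block \<open>x2 x1 x0\<close> into \<open>x2\<close> followed by two single
    blocks.\<close>
  show "bij_betw (\<lambda>h. h ! 1 # h) (symmetric_words u (1 # 1 # l)) (symmetric_words (1 # u) (3 # l))"
    by (rule bij_betwI[where g = tl])
      (auto simp: symmetric_words_def assms numeral_eq_Suc length_Suc_conv)
qed (use assms in simp_all)

lemma meander_index_1_4:
  assumes "sum_list u = 3 + sum_list l"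
  shows "meander_index (1 # u) (4 # l) = meander_index u (2 # 1 # l)"
proof (rule meander_index_eq)
  show "bij_betw (\<lambda>h. h ! 2 # h) (symmetric_words u (2 # 1 # l)) (symmetric_words (1 # u) (4 # l))"
    by (rule bij_betwI[where g = tl])
      (auto simp: symmetric_words_def assms numeral_eq_Suc length_Suc_conv)
qed (use assms in simp_all)

lemma meander_index_3_4:
  assumes "sum_list u = 1 + sum_list l"
  shows "meander_index (3 # u) (4 # l) = meander_index u (1 # l)"
proof (rule meander_index_eq)
  show "bij_betw (\<lambda>h. hd h # hd h # hd h # h) (symmetric_words u (1 # l))
      (symmetric_words (3 # u) (4 # l))"
    by (rule bij_betwI[where g = "drop 3"])
      (auto simp: symmetric_words_def assms numeral_eq_Suc length_Suc_conv)
qed (use assms in simp_all)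

lemma meander_index_4_11:
  assumes "2 + sum_list u = sum_list l"
  shows "meander_index (4 # u) (1 # 1 # l) = meander_index (1 # 1 # u) l"
proof (rule meander_index_eq)
  \<comment> \<open>The first two positions demand \<open>x0 = x3\<close> and
    \<open>x1 = x2\<close>; after deleting \<open>x0\<close> and \<open>x1\<close>, the letters
    still facing \<open>l\<close> are \<open>x2 x3\<close> in this order, hence the two single
    blocks above.\<close>
  show "bij_betw (\<lambda>h. h ! 1 # h ! 0 # h) (symmetric_words (1 # 1 # u) l)
      (symmetric_words (4 # u) (1 # 1 # l))"
    by (rule bij_betwI[where g = "drop 2"])
      (auto simp: symmetric_words_def assms[symmetric] numeral_eq_Suc length_Suc_conv)
qed (use assms in simp_all)

lemma meander_index_1_21:
  assumes "sum_list u = 2 + sum_list l"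
  shows "meander_index (1 # u) (2 # 1 # l) = meander_index u (1 # 1 # l)"
proof (rule meander_index_eq)
  show "bij_betw (\<lambda>h. hd h # h) (symmetric_words u (1 # 1 # l))
      (symmetric_words (1 # u) (2 # 1 # l))"
    by (rule bij_betwI[where g = tl])
      (auto simp: symmetric_words_def assms numeral_eq_Suc length_Suc_conv)
qed (use assms in simp_all)

lemma meander_index_4_21:
  assumes "1 + sum_list u = sum_list l"
  shows "meander_index (4 # u) (2 # 1 # l) = meander_index (1 # u) l"
proof (rule meander_index_eq)
  show "bij_betw (\<lambda>h. hd h # hd h # hd h # h) (symmetric_words (1 # u) l)
      (symmetric_words (4 # u) (2 # 1 # l))"
    by (rule bij_betwI[where g = "drop 3"])
      (auto simp: symmetric_words_def assms[symmetric] numeral_eq_Suc length_Suc_conv)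
qed (use assms in simp_all)

lemma meander_index_3_11:
  assumes "1 + sum_list u = sum_list l"
  shows "meander_index (3 # u) (1 # 1 # l) = 1 + meander_index (1 # u) l"
proof (rule meander_index_add)
  \<comment> \<open>The second letter is compared only with itself, so it is free; geometrically it
    is an isolated vertex.\<close>
  show "bij_betw (\<lambda>(b, h). hd h # b @ h) ({b. length b = 1} \<times> symmetric_words (1 # u) l)
      (symmetric_words (3 # u) (1 # 1 # l))"
    by (rule bij_betwI[where g = "\<lambda>h. ([h ! 1], drop 2 h)"])
      (auto simp: symmetric_words_def assms[symmetric] numeral_eq_Suc length_Suc_conv)
qed (use assms in simp_all)

lemma meander_index_3_21:
  assumes "sum_list u = sum_list l"
  shows "meander_index (3 # u) (2 # 1 # l) = 1 + meander_index u l"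
proof (rule meander_index_add)
  have shape: "\<exists>x t. h = x # x # x # t \<and> t \<in> symmetric_words u l"
    if h: "h \<in> symmetric_words (3 # u) (2 # 1 # l)" for h
  proof -
    have "length h = Suc (Suc (Suc (sum_list u)))"
      using h by (simp add: symmetric_words_def)
    then obtain x y z t where t: "h = x # y # z # t" "length t = sum_list u"
      by (auto simp: length_Suc_conv)
    \<comment> \<open>The first three positions require \<open>z = y\<close>, \<open>y = x\<close>
      and \<open>x = z\<close>, so only the constant triples survive the Boolean case split.\<close>
    then show ?thesis
      using h by (cases x; cases y; cases z) (auto simp: symmetric_words_def numeral_eq_Suc)
  qed
  show "bij_betw (\<lambda>(b, h). hd b # hd b # hd b # h) ({b. length b = 1} \<times> symmetric_words u l)
      (symmetric_words (3 # u) (2 # 1 # l))"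
  proof (rule bij_betwI[where g = "\<lambda>h. ([hd h], drop 3 h)"])
    show "(\<lambda>(b, h). hd b # hd b # hd b # h)
        \<in> {b. length b = 1} \<times> symmetric_words u l \<rightarrow> symmetric_words (3 # u) (2 # 1 # l)"
      by (auto simp: symmetric_words_def assms numeral_eq_Suc)
  qed (use shape in \<open>fastforce simp: numeral_eq_Suc length_Suc_conv\<close>)+
qed (use assms in simp_all)

section \<open>Dilation of a meander\<close>

lemma set_block_rev [simp]: "set (block_rev u h) = set h"
proof (induction u arbitrary: h)
  case (Cons a u)
  have "set (take a h) \<union> set (drop a h) = set h"
    by (metis append_take_drop_id set_append)
  then show ?case using Cons by simp
qed simp

lemma concat_take_drop_uniform:
  assumes "\<And>b. b \<in> set H \<Longrightarrow> length b = c"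
  shows "take (c * a) (concat H) = concat (take a H)" "drop (c * a) (concat H) = concat (drop a H)"
  using assms
proof (induction H arbitrary: a)
  case (Cons b H)
  { case 1 then show ?case using Cons.IH(1) by (cases a) auto }
  { case 2 then show ?case using Cons.IH(2) by (cases a) auto }
qed simp_all

text \<open>Reversing a dilated block reverses the order of its letters and each letter itself. The
  resulting \<open>map rev\<close> is the same for both compositions and injective, so it cancels
  from the symmetry condition.\<close>

lemma block_rev_dilate:
  assumes "\<And>b. b \<in> set H \<Longrightarrow> length b = c" "sum_list u = length H"
  shows "block_rev (map ((*) c) u) (concat H) = concat (map rev (block_rev u H))"
  using assms
proof (induction u arbitrary: H)
  case (Cons a u)
  have "block_rev (map ((*) c) u) (concat (drop a H)) = concat (map rev (block_rev u (drop a H)))"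
    using Cons.prems by (intro Cons.IH) (auto dest: in_set_dropD)
  moreover have "rev (concat (take a H)) = concat (map rev (rev (take a H)))"
    by (simp add: rev_concat rev_map)
  ultimately show ?case
    using Cons.prems by (simp add: concat_take_drop_uniform)
qed simp

lemma sum_list_dilate: "sum_list (map ((*) c) u) = c * sum_list (u :: nat list)"
  by (simp add: sum_list_const_mult)

text \<open>A symmetric word of the dilated meander is a symmetric word of the original one over the
  alphabet of the \<open>2 ^ c\<close> Boolean lists of length \<open>c\<close>.\<close>

lemma meander_index_dilate:
  assumes sum: "sum_list u = sum_list l"
  shows "meander_index (map ((*) c) u) (map ((*) c) l) = c * meander_index u l"
proof -
  let ?A = "{b :: bool list. length b = c}"
  have card_A: "card ?A = 2 ^ c"
    using card_lists_length_eq[of "UNIV :: bool set" c] by simp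
  \<comment> \<open>Letters of common length \<open>c\<close> can be cut out of the concatenation in
    only one way.\<close>
  have inj: "H = H'" if "concat H = concat H'" "length H = length H'" "set H \<subseteq> ?A" "set H' \<subseteq> ?A"
    for H H' :: "bool list list"
    using that by (intro concat_injective) (fastforce dest: set_zip_leftD set_zip_rightD)+
  have "bij_betw concat {H. length H = sum_list u \<and> set H \<subseteq> ?A \<and> block_rev u H = block_rev l H}
      (symmetric_words (map ((*) c) u) (map ((*) c) l))"
    unfolding bij_betw_def
  proof (intro conjI inj_onI set_eqI iffI)
    fix H H' assume "H \<in> {H. length H = sum_list u \<and> set H \<subseteq> ?A \<and> block_rev u H = block_rev l H}"
      "H' \<in> {H. length H = sum_list u \<and> set H \<subseteq> ?A \<and> block_rev u H = block_rev l H}"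
      "concat H = concat H'"
    then show "H = H'" by (intro inj) auto
  next
    fix h assume "h \<in> concat ` {H. length H = sum_list u \<and> set H \<subseteq> ?A \<and> block_rev u H = block_rev l H}"
    then obtain H where H: "h = concat H" "length H = sum_list u" "\<And>b. b \<in> set H \<Longrightarrow> length b = c"
      "block_rev u H = block_rev l H" by blast
    have "length (concat H) = c * length H"
      using H(3) by (induction H) auto
    then show "h \<in> symmetric_words (map ((*) c) u) (map ((*) c) l)"
      using H sum by (simp add: symmetric_words_def sum_list_dilate block_rev_dilate)
  next
    fix h assume h: "h \<in> symmetric_words (map ((*) c) u) (map ((*) c) l)"
    have chunks: "\<exists>H. h = concat H \<and> length H = n \<and> set H \<subseteq> ?A" if "length h = c * n" for h :: "bool list" and n
      using that
    proof (induction n arbitrary: h)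
      case (Suc n)
      from Suc.IH[of "drop c h"] Suc.prems obtain H where "drop c h = concat H" "length H = n" "set H \<subseteq> ?A"
        by auto
      then have "h = concat (take c h # H)" "length (take c h # H) = Suc n" "set (take c h # H) \<subseteq> ?A"
        using Suc.prems append_take_drop_id[of c h] by auto
      then show ?case by blast
    qed simp
    have "length h = c * sum_list u"
      using h by (simp add: symmetric_words_def sum_list_dilate)
    from chunks[OF this] obtain H where H: "h = concat H" "length H = sum_list u" "set H \<subseteq> ?A"
      by blast
    then have "\<And>b. b \<in> set H \<Longrightarrow> length b = c" by blast
    then have "concat (map rev (block_rev u H)) = concat (map rev (block_rev l H))"
      using h sum H(1,2) block_rev_dilate[of H c u] block_rev_dilate[of H c l]
      by (simp add: symmetric_words_def)
    then have "map rev (block_rev u H) = map rev (block_rev l H)"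
      using H by (intro inj) auto
    then have "block_rev u H = block_rev l H"
      by (simp add: inj_map_eq_map)
    with H show "h \<in> concat ` {H. length H = sum_list u \<and> set H \<subseteq> ?A \<and> block_rev u H = block_rev l H}"
      by blast
  qed
  from bij_betw_same_card[OF this]
  have "(2::nat) ^ meander_index (map ((*) c) u) (map ((*) c) l) = (2 ^ c) ^ meander_index u l"
    unfolding card_symmetric_words[OF sum] card_A
    using sum by (simp add: card_symmetric_bool_words sum_list_dilate)
  then show ?thesis by (simp flip: power_mult)
qed

section \<open>Generating functions\<close>

text \<open>Positive parts bound the length of a composition by its sum, so each coefficient counts
  a finite set.\<close>

definition balanced_pairs :: "(nat list \<times> nat list) set" where
  "balanced_pairs = {(u, l). sum_list u = sum_list l \<and> 0 \<notin> set u \<and> 0 \<notin> set l}"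

definition pairs_of :: "(nat list \<times> nat list) set \<Rightarrow> nat \<Rightarrow> nat \<Rightarrow> (nat list \<times> nat list) set" where
  "pairs_of S n k = {(u, l) \<in> S. sum_list u = n \<and> meander_index u l = k}"

definition pairs_gf :: "(nat list \<times> nat list) set \<Rightarrow> rat fps fps" where
  "pairs_gf S = Abs_fps (\<lambda>n. Abs_fps (\<lambda>k. of_nat (card (pairs_of S n k))))"

lemma length_le_sum_list: "0 \<notin> set u \<Longrightarrow> length u \<le> sum_list (u :: nat list)"
  by (induction u) auto

lemma finite_pairs_of:
  assumes "S \<subseteq> balanced_pairs"
  shows "finite (pairs_of S n k)"
proof -
  let ?L = "{u. set u \<subseteq> {..n} \<and> length u \<le> n}"
  have "u \<in> ?L \<and> l \<in> ?L" if "(u, l) \<in> pairs_of S n k" for u l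
    using that assms length_le_sum_list[of u] length_le_sum_list[of l]
      member_le_sum_list[of _ u] member_le_sum_list[of _ l]
    by (auto simp: pairs_of_def balanced_pairs_def)
  then have "pairs_of S n k \<subseteq> ?L \<times> ?L" by auto
  moreover have "finite ?L" by (rule finite_lists_length_le) simp
  ultimately show ?thesis by (meson finite_SigmaI finite_subset)
qed

lemma pairs_gf_Un:
  assumes "S \<subseteq> balanced_pairs" "T \<subseteq> balanced_pairs" "S \<inter> T = {}"
  shows "pairs_gf (S \<union> T) = pairs_gf S + pairs_gf T"
proof -
  have "pairs_of (S \<union> T) n k = pairs_of S n k \<union> pairs_of T n k"
    and "pairs_of S n k \<inter> pairs_of T n k = {}" for n k
    using assms(3) by (auto simp: pairs_of_def)
  then show ?thesis
    using finite_pairs_of assms(1,2)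
    by (simp add: fps_eq_iff pairs_gf_def card_Un_disjoint)
qed

text \<open>Turns a bijection that raises the weight by \<open>d\<close> and the index by
  \<open>e\<close> into multiplication by a monomial.\<close>

lemma pairs_gf_shift:
  assumes bij: "bij_betw \<phi> T S"
    and weight: "\<And>p. p \<in> T \<Longrightarrow> sum_list (fst (\<phi> p)) = d + sum_list (fst p)"
    and index: "\<And>p. p \<in> T \<Longrightarrow> meander_index (fst (\<phi> p)) (snd (\<phi> p)) = e + meander_index (fst p) (snd p)"
  shows "pairs_gf S = var_x ^ d * var_y ^ e * pairs_gf T"
proof -
  have S: "S = \<phi> ` T" and inj: "inj_on \<phi> T" using bij by (simp_all add: bij_betw_def)
  have mem: "p \<in> pairs_of R n k \<longleftrightarrow>
      p \<in> R \<and> sum_list (fst p) = n \<and> meander_index (fst p) (snd p) = k" for p R n k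
    by (cases p) (simp add: pairs_of_def)
  have image: "\<phi> p \<in> pairs_of S (d + n) (e + k) \<longleftrightarrow> p \<in> pairs_of T n k" if "p \<in> T" for p n k
    using that weight[OF that] index[OF that] by (simp add: mem S)
  have card: "card (pairs_of S (d + n) (e + k)) = card (pairs_of T n k)" for n k
  proof -
    have "pairs_of S (d + n) (e + k) = \<phi> ` pairs_of T n k"
    proof (intro equalityI subsetI)
      fix q assume q: "q \<in> pairs_of S (d + n) (e + k)"
      then obtain p where "p \<in> T" "q = \<phi> p" by (auto simp: mem S)
      with q image show "q \<in> \<phi> ` pairs_of T n k" by blast
    next
      fix q assume "q \<in> \<phi> ` pairs_of T n k"
      then obtain p where "p \<in> pairs_of T n k" "q = \<phi> p" by blast
      with image[of p] show "q \<in> pairs_of S (d + n) (e + k)" by (simp add: mem)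
    qed
    moreover have "inj_on \<phi> (pairs_of T n k)"
      using inj by (rule inj_on_subset) (auto simp: mem)
    ultimately show ?thesis by (simp add: card_image)
  qed
  \<comment> \<open>Below the shift the coefficients must vanish; there the truncated differences
    \<open>n - d\<close> and \<open>k - e\<close> carry no information.\<close>
  have empty: "pairs_of S n k = {}" if nk: "n < d \<or> k < e" for n k
  proof (rule equals0I)
    fix q assume q: "q \<in> pairs_of S n k"
    then obtain p where p: "p \<in> T" "q = \<phi> p" by (auto simp: mem S)
    with q nk weight[OF p(1)] index[OF p(1)] show False by (simp add: mem)
  qed
  have "card (pairs_of S n k) = (if n < d \<or> k < e then 0 else card (pairs_of T (n - d) (k - e)))" for n k
    using card[of "n - d" "k - e"] empty[of n k] by auto
  then show ?thesis
    by (simp add: fps_eq_iff pairs_gf_def var_x_def var_y_def mult.assoc fps_X_power_mult_nth)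
qed

section \<open>Meanders with parts 1, 3, 4, sorted by their left ends\<close>

definition J134 :: "nat set" where "J134 = {1, 3, 4}"

text \<open>The prefix \<open>p\<close> is what a reduction leaves of a broken block. It may have
  parts outside \<open>J134\<close>, as in \<open>[2, 1]\<close>.\<close>

definition state :: "nat list \<Rightarrow> (nat list \<times> nat list) set" where
  "state p = {(u, p @ l) |u l. set u \<subseteq> J134 \<and> set l \<subseteq> J134 \<and> sum_list u = sum_list p + sum_list l}"

definition step :: "nat \<Rightarrow> nat list \<Rightarrow> (nat list \<times> nat list) set" where
  "step a p = {(a # u, p @ l) |u l. set u \<subseteq> J134 \<and> set l \<subseteq> J134 \<and> a + sum_list u = sum_list p + sum_list l}"

abbreviation state_gf :: "nat list \<Rightarrow> rat fps fps" where
  "state_gf p \<equiv> pairs_gf (state p)"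

abbreviation step_gf :: "nat \<Rightarrow> nat list \<Rightarrow> rat fps fps" where
  "step_gf a p \<equiv> pairs_gf (step a p)"

lemma step_balanced: "a \<noteq> 0 \<Longrightarrow> 0 \<notin> set p \<Longrightarrow> step a p \<subseteq> balanced_pairs"
  by (auto simp: step_def balanced_pairs_def J134_def)

text \<open>The weight is the sum of the upper composition, so the power of \<open>x\<close> is the part removed from
  the upper side: \<open>a\<close> here, and \<open>sum_list p\<close> when the two sides change places.\<close>

lemma step_gf_straight:
  assumes "sum_list p = a + sum_list q"
    and "\<And>u l. sum_list u = sum_list q + sum_list l \<Longrightarrow>
      meander_index (a # u) (p @ l) = e + meander_index u (q @ l)"
  shows "step_gf a p = var_x ^ a * var_y ^ e * state_gf q"
proof (rule pairs_gf_shift)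
  \<comment> \<open>The lower composition of a pair in \<open>state q\<close> has the form
    \<open>q @ l\<close>, and dropping \<open>length q\<close> parts recovers
    \<open>l\<close>.\<close>
  let ?f = "\<lambda>(u, m). (a # u, p @ drop (length q) m)"
  show "bij_betw ?f (state q) (step a p)"
    by (rule bij_betwI[where g = "\<lambda>(u, m). (tl u, q @ drop (length p) m)"])
      (use assms(1) in \<open>auto simp: state_def step_def\<close>)
qed (use assms in \<open>auto simp: state_def\<close>)

text \<open>Here the reduction uses up the prefix \<open>p\<close> and breaks the upper part
  \<open>a\<close>, leaving \<open>q\<close> on the upper side. Exchanging the sides brings the
  result back to the form of a \<open>state\<close>.\<close>

lemma step_gf_swapped:
  assumes "a = sum_list p + sum_list q"
    and "\<And>u l. sum_list l = sum_list q + sum_list u \<Longrightarrow>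
      meander_index (a # u) (p @ l) = e + meander_index l (q @ u)"
  shows "step_gf a p = var_x ^ sum_list p * var_y ^ e * state_gf q"
proof (rule pairs_gf_shift)
  let ?f = "\<lambda>(u, m). (a # drop (length q) m, p @ u)"
  show "bij_betw ?f (state q) (step a p)"
    by (rule bij_betwI[where g = "\<lambda>(u, m). (drop (length p) m, q @ tl u)"])
      (use assms(1) in \<open>auto simp: state_def step_def\<close>)
qed (use assms in \<open>auto simp: state_def\<close>)

text \<open>A nonempty prefix of positive parts forces a first upper part, which must be 1, 3 or
  4.\<close>

lemma state_gf_step:
  assumes "0 \<notin> set p" "p \<noteq> []"
  shows "state_gf p = step_gf 1 p + step_gf 3 p + step_gf 4 p"
proof -
  have pos: "sum_list p > 0" using assms by (cases p) auto
  have "state p = step 1 p \<union> step 3 p \<union> step 4 p"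
  proof (intro equalityI subsetI)
    fix x assume "x \<in> state p"
    then obtain u l where x: "x = (u, p @ l)" "set u \<subseteq> J134" "set l \<subseteq> J134"
      "sum_list u = sum_list p + sum_list l" by (auto simp: state_def)
    with pos have "sum_list u > 0" by linarith
    then obtain a v where "u = a # v" by (cases u) auto
    with x show "x \<in> step 1 p \<union> step 3 p \<union> step 4 p"
      by (auto simp: step_def J134_def)
  qed (auto simp: state_def step_def J134_def)
  moreover have "step 1 p \<inter> step 3 p = {}" "(step 1 p \<union> step 3 p) \<inter> step 4 p = {}"
    by (auto simp: step_def)
  moreover have "step a p \<subseteq> balanced_pairs" if "a \<noteq> 0" for a
    using assms that by (intro step_balanced)
  ultimately show ?thesis by (simp add: pairs_gf_Un)
qed

lemma meander_index_Nil: "meander_index [] [] = 0"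
  by (simp add: meander_index_def components_def)

lemma pairs_gf_empty_meander: "pairs_gf {([], [])} = 1"
proof -
  have "pairs_of {([], [])} n k = (if n = 0 \<and> k = 0 then {([], [])} else {})" for n k
    by (auto simp: pairs_of_def meander_index_Nil)
  then show ?thesis by (simp add: fps_eq_iff pairs_gf_def)
qed

text \<open>A nonempty meander is classified by its first lower part, which becomes the prefix, and
  then by its first upper part.\<close>

lemma state_gf_Nil:
  "state_gf [] = 1 + (step_gf 1 [1] + step_gf 3 [1] + step_gf 4 [1])
    + (step_gf 1 [3] + step_gf 3 [3] + step_gf 4 [3])
    + (step_gf 1 [4] + step_gf 3 [4] + step_gf 4 [4])"
proof -
  have state_single: "state_gf [b] = step_gf 1 [b] + step_gf 3 [b] + step_gf 4 [b]" if "b \<noteq> 0" for b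
    using that by (intro state_gf_step) auto
  have bal: "state [b] \<subseteq> balanced_pairs" if "b \<noteq> 0" for b
    using that by (auto simp: state_def balanced_pairs_def J134_def)
  have "state [] = {([], [])} \<union> state [1] \<union> state [3] \<union> state [4]"
  proof (intro equalityI subsetI)
    fix x assume "x \<in> state []"
    then obtain u l where x: "x = (u, l)" "set u \<subseteq> J134" "set l \<subseteq> J134"
      "sum_list u = sum_list l" by (auto simp: state_def)
    show "x \<in> {([], [])} \<union> state [1] \<union> state [3] \<union> state [4]"
    proof (cases l)
      case Nil
      with x have "u = []" by (cases u) (auto simp: J134_def)
      with x Nil show ?thesis by simp
    qed (use x in \<open>auto simp: state_def J134_def\<close>)
  qed (auto simp: state_def J134_def)
  moreover have "pairs_gf ({([], [])} \<union> state [1]) = 1 + state_gf [1]"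
    using bal[of 1] pairs_gf_Un[of "{([], [])}" "state [1]"] pairs_gf_empty_meander
    by (auto simp: state_def balanced_pairs_def)
  moreover have "pairs_gf ({([], [])} \<union> state [1] \<union> state [3])
      = pairs_gf ({([], [])} \<union> state [1]) + state_gf [3]"
    using bal[of 1] bal[of 3] by (intro pairs_gf_Un) (auto simp: state_def balanced_pairs_def)
  moreover have "pairs_gf ({([], [])} \<union> state [1] \<union> state [3] \<union> state [4])
      = pairs_gf ({([], [])} \<union> state [1] \<union> state [3]) + state_gf [4]"
    using bal[of 1] bal[of 3] bal[of 4]
    by (intro pairs_gf_Un) (auto simp: state_def balanced_pairs_def)
  ultimately have "state_gf [] = 1 + state_gf [1] + state_gf [3] + state_gf [4]"
    by (simp only:)
  then show ?thesis by (simp add: state_single)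
qed

section \<open>The transitions between the states\<close>

lemma step_gf_same: "step_gf a [a] = var_x ^ a * var_y ^ a * state_gf []"
  by (rule step_gf_straight) (simp_all add: meander_index_Cons_same)

lemma step_gf_1_3: "step_gf 1 [3] = var_x * state_gf [1, 1]"
  using step_gf_straight[of "[3]" 1 "[1, 1]" 0] by (simp add: meander_index_1_3[simplified])

lemma step_gf_1_4: "step_gf 1 [4] = var_x * state_gf [2, 1]"
  using step_gf_straight[of "[4]" 1 "[2, 1]" 0] by (simp add: meander_index_1_4[simplified])

lemma step_gf_3_4: "step_gf 3 [4] = var_x ^ 3 * state_gf [1]"
  using step_gf_straight[of "[4]" 3 "[1]" 0] by (simp add: meander_index_3_4[simplified])

text \<open>The mirror image of the step with 1 above 3: symmetry of the index reduces it to the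
  same rule, with the sides exchanged.\<close>

lemma step_gf_3_1: "step_gf 3 [1] = var_x * state_gf [1, 1]"
proof -
  have "meander_index (3 # u) ([1] @ l) = 0 + meander_index l ([1, 1] @ u)"
    if "sum_list l = sum_list [1, 1] + sum_list u" for u l
    using that meander_index_1_3[of l u] meander_index_commute[of "3 # u" "1 # l"] by simp
  then have "step_gf 3 [1] = var_x ^ sum_list [1] * var_y ^ 0 * state_gf [1, 1]"
    by (intro step_gf_swapped) auto
  then show ?thesis by simp
qed

lemma step_gf_4_1: "step_gf 4 [1] = var_x * state_gf [2, 1]"
proof -
  have "meander_index (4 # u) ([1] @ l) = 0 + meander_index l ([2, 1] @ u)"
    if "sum_list l = sum_list [2, 1] + sum_list u" for u l
    using that meander_index_1_4[of l u] meander_index_commute[of "4 # u" "1 # l"] by simp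
  then have "step_gf 4 [1] = var_x ^ sum_list [1] * var_y ^ 0 * state_gf [2, 1]"
    by (intro step_gf_swapped) auto
  then show ?thesis by simp
qed

lemma step_gf_4_3: "step_gf 4 [3] = var_x ^ 3 * state_gf [1]"
proof -
  have "meander_index (4 # u) ([3] @ l) = 0 + meander_index l ([1] @ u)"
    if "sum_list l = sum_list [1] + sum_list u" for u l
    using that meander_index_3_4[of l u] meander_index_commute[of "4 # u" "3 # l"] by simp
  then have "step_gf 4 [3] = var_x ^ sum_list [3] * var_y ^ 0 * state_gf [1]"
    by (intro step_gf_swapped) auto
  then show ?thesis by simp
qed

lemma step_gf_1_11: "step_gf 1 [1, 1] = var_x * var_y * state_gf [1]"
  using step_gf_straight[of "[1, 1]" 1 "[1]" 1] by (simp add: meander_index_Cons_same[of _ _ 1, simplified])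

lemma step_gf_3_11: "step_gf 3 [1, 1] = var_x ^ 2 * var_y * state_gf [1]"
proof -
  have "meander_index (3 # u) ([1, 1] @ l) = 1 + meander_index l ([1] @ u)"
    if "sum_list l = sum_list [1] + sum_list u" for u l
    using that meander_index_3_11[of u l] meander_index_commute[of "1 # u" l] by simp
  then have "step_gf 3 [1, 1] = var_x ^ sum_list [1, 1] * var_y ^ 1 * state_gf [1]"
    by (intro step_gf_swapped) auto
  then show ?thesis by (simp add: numeral_2_eq_2)
qed

text \<open>The reduction reproduces the prefix \<open>[1, 1]\<close> on the upper side, so after
  exchanging sides this state feeds back into itself.\<close>

lemma step_gf_4_11: "step_gf 4 [1, 1] = var_x ^ 2 * state_gf [1, 1]"
proof -
  have "meander_index (4 # u) ([1, 1] @ l) = 0 + meander_index l ([1, 1] @ u)"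
    if "sum_list l = sum_list [1, 1] + sum_list u" for u l
    using that meander_index_4_11[of u l] meander_index_commute[of "1 # 1 # u" l] by simp
  then have "step_gf 4 [1, 1] = var_x ^ sum_list [1, 1] * var_y ^ 0 * state_gf [1, 1]"
    by (intro step_gf_swapped) auto
  then show ?thesis by (simp add: numeral_2_eq_2)
qed

lemma step_gf_1_21: "step_gf 1 [2, 1] = var_x * state_gf [1, 1]"
  using step_gf_straight[of "[2, 1]" 1 "[1, 1]" 0] by (simp add: meander_index_1_21[simplified])

lemma step_gf_3_21: "step_gf 3 [2, 1] = var_x ^ 3 * var_y * state_gf []"
  using step_gf_straight[of "[2, 1]" 3 "[]" 1] by (simp add: meander_index_3_21[simplified])

lemma step_gf_4_21: "step_gf 4 [2, 1] = var_x ^ 3 * state_gf [1]"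
proof -
  have "meander_index (4 # u) ([2, 1] @ l) = 0 + meander_index l ([1] @ u)"
    if "sum_list l = sum_list [1] + sum_list u" for u l
    using that meander_index_4_21[of u l] meander_index_commute[of "1 # u" l] by simp
  then have "step_gf 4 [2, 1] = var_x ^ sum_list [2, 1] * var_y ^ 0 * state_gf [1]"
    by (intro step_gf_swapped) auto
  then show ?thesis by (simp add: numeral_3_eq_3)
qed

lemma meander_gf_134: "meander_gf {1, 3, 4} = state_gf []"
proof -
  have "{(u, l). (u, l) \<in> meanders n \<and> set u \<subseteq> {1, 3, 4} \<and> set l \<subseteq> {1, 3, 4} \<and> meander_index u l = k}
    = pairs_of (state []) n k" for n k
    by (auto simp: pairs_of_def state_def J134_def meanders_def composition_def)
  then show ?thesis
    by (simp add: meander_gf_def meander_count_def pairs_gf_def)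
qed

section \<open>Division and substitution of power series\<close>

text \<open>The coefficients are themselves power series, not a field. A denominator with constant
  coefficient 1 is still a unit, provided \<open>inverse\<close> sends 1 to 1.\<close>

lemma fps_divide_eqI:
  fixes f g h :: "'a :: {idom, inverse} fps"
  assumes "h * g = f" "fps_nth g 0 = 1" "inverse (1 :: 'a) = 1"
  shows "f / g = h"
proof -
  have "g * inverse g = 1"
    using assms fps_right_inverse[of g 1] by (simp add: fps_inverse_def)
  then have "h * g * inverse g = h" by (simp add: mult.assoc)
  then show ?thesis using assms by (simp add: fps_divide_unit)
qed

lemma fps_compose_X_power_nth:
  assumes "c \<ge> 1"
  shows "fps_nth (fps_compose F (fps_X ^ c)) n = (if c dvd n then fps_nth F (n div c) else 0)"
proof -
  have "fps_nth (fps_compose F (fps_X ^ c)) n = (\<Sum>i = 0..n. if n = c * i then fps_nth F i else 0)"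
    unfolding fps_compose_nth by (intro sum.cong refl) (simp add: fps_X_power_nth flip: power_mult)
  also have "\<dots> = (if c dvd n then fps_nth F (n div c) else 0)"
  proof (cases "c dvd n")
    case True
    then obtain m where m: "n = c * m" by blast
    then have "m \<le> n" using assms by simp
    then show ?thesis using m assms by (simp add: sum.delta')
  qed (auto intro!: sum.neutral)
  finally show ?thesis .
qed

lemma meander_count_dilate:
  assumes c: "c \<ge> 1" and J: "0 \<notin> J"
  shows "meander_count ((*) c ` J) n k =
    (if c dvd n \<and> c dvd k then meander_count J (n div c) (k div c) else 0)"
proof -
  let ?S = "\<lambda>J n k. {(u, l). (u, l) \<in> meanders n \<and> set u \<subseteq> J \<and> set l \<subseteq> J \<and> meander_index u l = k}"
  let ?d = "map ((*) c)"
  have dilate: "(?d u, ?d l) \<in> ?S ((*) c ` J) n k \<longleftrightarrow>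
      c dvd n \<and> c dvd k \<and> (u, l) \<in> ?S J (n div c) (k div c)" if ul: "set u \<subseteq> J" "set l \<subseteq> J" for u l
  proof -
    have pos: "\<And>v. set v \<subseteq> J \<Longrightarrow> \<forall>a\<in>set v. a \<ge> 1" using J by (metis less_one not_le subsetD)
    have "(?d u, ?d l) \<in> ?S ((*) c ` J) n k \<longleftrightarrow>
        c * sum_list u = n \<and> sum_list u = sum_list l \<and> meander_index (?d u) (?d l) = k"
      using ul pos[OF ul(1)] pos[OF ul(2)] c
      by (auto simp: meanders_def composition_def sum_list_dilate)
    also have "\<dots> \<longleftrightarrow> c * sum_list u = n \<and> sum_list u = sum_list l \<and> c * meander_index u l = k"
      using meander_index_dilate[of u l c] by auto
    also have "\<dots> \<longleftrightarrow> c dvd n \<and> c dvd k \<and> (u, l) \<in> ?S J (n div c) (k div c)"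
      using ul pos[OF ul(1)] pos[OF ul(2)] c
      by (auto simp: meanders_def composition_def)
    finally show ?thesis .
  qed
  have "?S ((*) c ` J) n k = map_prod ?d ?d ` (if c dvd n \<and> c dvd k then ?S J (n div c) (k div c) else {})"
  proof (intro equalityI subsetI)
    fix x assume x: "x \<in> ?S ((*) c ` J) n k"
    then have "fst x \<in> lists ((*) c ` J)" "snd x \<in> lists ((*) c ` J)" by auto
    then obtain u l where "x = (?d u, ?d l)" "set u \<subseteq> J" "set l \<subseteq> J"
      unfolding lists_image by (cases x) auto
    with x dilate[of u l]
    show "x \<in> map_prod ?d ?d ` (if c dvd n \<and> c dvd k then ?S J (n div c) (k div c) else {})"
      by auto
  next
    fix x assume "x \<in> map_prod ?d ?d ` (if c dvd n \<and> c dvd k then ?S J (n div c) (k div c) else {})"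
    then obtain u l where ul: "x = (?d u, ?d l)" "c dvd n" "c dvd k" "(u, l) \<in> ?S J (n div c) (k div c)"
      by (auto split: if_splits)
    then show "x \<in> ?S ((*) c ` J) n k"
      using dilate[of u l] by blast
  qed
  moreover have "inj (map_prod ?d ?d)"
    using c by (intro prod.inj_map) (auto simp: inj_on_def)
  ultimately show ?thesis
    unfolding meander_count_def by (simp add: card_image inj_on_subset)
qed

lemma meander_gf_dilate:
  assumes "c \<ge> 1" "0 \<notin> J"
  shows "meander_gf ((*) c ` J) = subst_powers c (meander_gf J)"
  using assms
  by (simp add: fps_eq_iff meander_gf_def subst_powers_def fps_compose_X_power_nth meander_count_dilate)

section \<open>Elimination and the closed form\<close>

text \<open>The system is linear in the four series. Elimination expresses \<open>f * B1\<close> and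
  \<open>f * B11\<close> through \<open>A\<close>, and the equation for \<open>A\<close>, multiplied
  by \<open>f\<close>, then involves \<open>A\<close> alone.\<close>

lemma state_gf_solution:
  fixes A B1 B11 B21 x y :: "'a :: idom"
  assumes A: "A = 1 + (x * y + x ^ 3 * y ^ 3 + x ^ 4 * y ^ 4) * A + 2 * x * B11 + 2 * x * B21 + 2 * x ^ 3 * B1"
    and B1: "B1 = x * y * A + x * B11 + x * B21"
    and B11: "B11 = x * y * B1 + x ^ 2 * y * B1 + x ^ 2 * B11"
    and B21: "B21 = x * B11 + x ^ 3 * y * A + x ^ 3 * B1"
    and nz: "1 + x \<noteq> 0" "1 - x \<noteq> 0"
  shows "A * (1 - x*(2 + y) + x^2*(2 + y) - x^3*(2 + 2*y + y^2 + y^3)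
             + x^4*(1 - 2*y + 2*y^3 - y^4) + x^5*(5*y - 2*y^3 + 3*y^4)
             + x^6*(- 4*y + 2*y^3 - 2*y^4 + y^5) + x^7*(2*y - y^3 + 2*y^4) - x^8*y^4)
    = 1 - 2*x + 2*x^2 - 2*x^3 + x^4 - x^2*y"
proof -
  \<comment> \<open>This is \<open>(1 - x)^2 * (1 + x^2) - x^2 * y\<close>, the coefficient of
    \<open>B1\<close> after eliminating \<open>B11\<close> and \<open>B21\<close> from its equation
    and cancelling \<open>1 + x\<close>.\<close>
  define f where "f = 1 - 2*x + 2*x^2 - 2*x^3 + x^4 - x^2*y"
  have "(1 + x) * ((1 - x) * B11) = (1 + x) * (x * y * B1)"
    using B11 by algebra
  then have B11': "(1 - x) * B11 = x * y * B1" using nz by simp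
  have "(1 + x) * (f * B1) = (1 + x) * ((1 - x) * ((1 - x + x ^ 2) * (x * y * A)))"
    unfolding f_def using B1 B11' B21 by algebra
  then have B1': "f * B1 = (1 - x) * ((1 - x + x ^ 2) * (x * y * A))" using nz by simp
  have "(1 - x) * (f * B11) = (1 - x) * ((1 - x + x ^ 2) * (x ^ 2 * y ^ 2 * A))"
    using B11' B1' by algebra
  then have B11'': "f * B11 = (1 - x + x ^ 2) * (x ^ 2 * y ^ 2 * A)" using nz by simp
  \<comment> \<open>With \<open>B21\<close> replaced, the remaining auxiliary series occur only as
    \<open>f * B1\<close> and \<open>f * B11\<close>, ready for substitution.\<close>
  have "f * A = f + f * (x * y + x ^ 3 * y ^ 3 + x ^ 4 * y ^ 4) * A + 2 * x * (f * B11)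
      + 2 * x * (x * (f * B11) + x ^ 3 * y * (f * A) + x ^ 3 * (f * B1)) + 2 * x ^ 3 * (f * B1)"
    using A B21 by algebra
  then show ?thesis
    unfolding B11'' B1' unfolding f_def by algebra
qed

theorem theorem4p4:
  fixes f g x y :: "rat fps fps"
  defines "x \<equiv> var_x" and "y \<equiv> var_y"
  defines "f \<equiv> 1 - 2*x + 2*x^2 - 2*x^3 + x^4 - x^2*y"
  defines "g \<equiv> 1 - x*(2 + y) + x^2*(2 + y) - x^3*(2 + 2*y + y^2 + y^3)
             + x^4*(1 - 2*y + 2*y^3 - y^4) + x^5*(5*y - 2*y^3 + 3*y^4)
             + x^6*(- 4*y + 2*y^3 - 2*y^4 + y^5) + x^7*(2*y - y^3 + 2*y^4) - x^8*y^4"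
  shows "meander_gf {1, 3, 4} = f / g \<and>
         (\<forall>c\<ge>1. meander_gf {c, 3*c, 4*c} = subst_powers c (meander_gf {1, 3, 4}))"
proof (intro conjI allI impI)
  have x0: "fps_nth x 0 = 0" by (simp add: x_def var_x_def)
  have "fps_nth (1 + x) 0 \<noteq> 0" "fps_nth (1 - x) 0 \<noteq> 0" by (simp_all add: x0)
  then have nz: "1 + x \<noteq> 0" "1 - x \<noteq> 0" by (metis fps_zero_nth)+
  have B1: "state_gf [1] = x * y * state_gf [] + x * state_gf [1, 1] + x * state_gf [2, 1]"
    using state_gf_step[of "[1]"] step_gf_same[of 1] step_gf_3_1 step_gf_4_1
    by (simp add: x_def y_def)
  have B11: "state_gf [1, 1] = x * y * state_gf [1] + x ^ 2 * y * state_gf [1] + x ^ 2 * state_gf [1, 1]"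
    using state_gf_step[of "[1, 1]"] step_gf_1_11 step_gf_3_11 step_gf_4_11
    by (simp add: x_def y_def)
  have B21: "state_gf [2, 1] = x * state_gf [1, 1] + x ^ 3 * y * state_gf [] + x ^ 3 * state_gf [1]"
    using state_gf_step[of "[2, 1]"] step_gf_1_21 step_gf_3_21 step_gf_4_21
    by (simp add: x_def y_def)
  have A: "state_gf [] = 1 + (x * y + x ^ 3 * y ^ 3 + x ^ 4 * y ^ 4) * state_gf []
      + 2 * x * state_gf [1, 1] + 2 * x * state_gf [2, 1] + 2 * x ^ 3 * state_gf [1]"
    using state_gf_Nil step_gf_same[of 1] step_gf_same[of 3] step_gf_same[of 4] step_gf_1_3
      step_gf_1_4 step_gf_3_4 step_gf_3_1 step_gf_4_1 step_gf_4_3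
    unfolding x_def y_def by (simp add: algebra_simps)
  have "state_gf [] * g = f"
    unfolding f_def g_def by (rule state_gf_solution[OF A B1 B11 B21 nz])
  moreover have "fps_nth g 0 = 1"
    by (simp add: g_def fps_mult_nth_0 x0 fps_nth_power_0)
  moreover have "inverse (1 :: rat fps) = 1" by simp
  ultimately show "meander_gf {1, 3, 4} = f / g"
    unfolding meander_gf_134 by (intro fps_divide_eqI[symmetric])
next
  fix c :: nat assume "c \<ge> 1"
  then show "meander_gf {c, 3*c, 4*c} = subst_powers c (meander_gf {1, 3, 4})"
    using meander_gf_dilate[of c "{1, 3, 4}"] by (simp add: mult.commute)
qed

end
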